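(* Let $K$ be any mod $2$ toric-colorable seed PL sphere of dimension $4$ with exactly $10$ vertices (equivalently, of dimension four and Picard number five). Then $K$ is toric-colorable. In fact, there is a map $\lambda: V(K)\to\{0,1\}^5\setminus\{0\}\subset\mathbb Z^5$, where $V(K)$ is the vertex set of $K$, such that for every facet $\sigma=\{v_1,\dots,v_5\}$ of $K$, $$\left|\det\bigl(\lambda(v_1),\dots,\lambda(v_5)\bigr)\right|=1,$$ where the determinant is computed over $\mathbb Z$.
   Context: A simplicial complex $K$ on $[m]=\{1,\dots,m\}$ is a collection of subsets of $[m]$ closed under taking subsets; here all complexes have no ghost vertices, i.e. $\{v\}\in K$ for every $v\in[m]$. A $k$-face is a face with $k+1$ elements; facets are maximal faces. $K$ is a PL sphere if its geometric realization is piecewise-linearly homeomorphic to the boundary of a simplex. If $K$ has dimension $n-1$ and $m$ vertices, its Picard number is $m-n$. Link: $K/v=\{\tau\in K: v\notin\tau,\ \tau\cup\{v\}\in K\}$. Join of complexes on disjoint vertex sets: $K_1\ast K_2=\{\sigma_1\cup\sigma_2:\sigma_i\in K_i\}$. Wedge operation at a vertex $v$ of $K$: with $I$ the full $1$-simplex on two new vertices $v_1,v_2$ and $\partial I=\{\emptyset,\{v_1\},\{v_2\}\}$, $\mathrm{Wed}_v(K)=(I\ast (K/v))\cup(\partial I\ast (K\setminus v))$, where $K\setminus v$ is the subcomplex of faces not containing $v$. A seed is a PL sphere that cannot be obtained from a PL sphere of smaller dimension by a (nonempty) sequence of wedge operations. An $(n-1)$-dimensional complex $K$ on $[m]$ is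 toric-colorable if there is a map $\lambda:[m]\to\mathbb Z^n$ such that for every $\sigma\in K$ the vectors $\lambda(i)$, $i\in\sigma$, can be extended to a $\mathbb Z$-basis of $\mathbb Z^n$. It is mod $2$ toric-colorable if there is a map $\lambda^{\mathbb R}:[m]\to\mathbb Z_2^n$ such that for every $\sigma\in K$ the vectors $\lambda^{\mathbb R}(i)$, $i\in\sigma$, are linearly independent over $\mathbb Z_2=\mathbb Z/2\mathbb Z$. *)

theory Defs
  imports
    "HOL-Library.Function_Algebras"
    "HOL-Library.Z2"
    "HOL-Analysis.Convex"
    "HOL-Analysis.Function_Topology"
    "Jordan_Normal_Form.VS_Connect"
begin

section \<open>Abstract simplicial complexes\<close>

text \<open>The vertex set of \<open>K\<close> is \<open>\<Union>K\<close>, so there are no ghost vertices by construction.\<close>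

definition simplicial_complex :: "'a set set \<Rightarrow> bool" where
  "simplicial_complex K \<longleftrightarrow>
     finite (\<Union>K) \<and> K \<noteq> {} \<and> (\<forall>\<sigma>\<in>K. \<forall>\<tau>. \<tau> \<subseteq> \<sigma> \<longrightarrow> \<tau> \<in> K)"

definition complex_dim :: "'a set set \<Rightarrow> int" where
  "complex_dim K = int (Max (card ` K)) - 1"

definition facets :: "'a set set \<Rightarrow> 'a set set" where
  "facets K = {\<sigma>\<in>K. \<forall>\<tau>\<in>K. \<sigma> \<subseteq> \<tau> \<longrightarrow> \<tau> = \<sigma>}"

definition isomorphic_complexes :: "'a set set \<Rightarrow> 'b set set \<Rightarrow> bool" where
  "isomorphic_complexes K L \<longleftrightarrow> (\<exists>f. inj_on f (\<Union>K) \<and> L = (\<lambda>\<sigma>. f ` \<sigma>) ` K)"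

definition link :: "'a set set \<Rightarrow> 'a \<Rightarrow> 'a set set" where
  "link K v = {\<tau>\<in>K. v \<notin> \<tau> \<and> insert v \<tau> \<in> K}"

definition deletion :: "'a set set \<Rightarrow> 'a \<Rightarrow> 'a set set" where
  "deletion K v = {\<tau>\<in>K. v \<notin> \<tau>}"

definition join :: "'a set set \<Rightarrow> 'a set set \<Rightarrow> 'a set set" where
  "join K L = {\<sigma> \<union> \<tau> | \<sigma> \<tau>. \<sigma> \<in> K \<and> \<tau> \<in> L}"

definition wedge :: "'a set set \<Rightarrow> 'a \<Rightarrow> 'a \<Rightarrow> 'a \<Rightarrow> 'a set set" where
  "wedge K v v1 v2 =
     join {{}, {v1}, {v2}, {v1, v2}} (link K v) \<union> join {{}, {v1}, {v2}} (deletion K v)"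

definition wedge_step :: "'a set set \<Rightarrow> 'a set set \<Rightarrow> bool" where
  "wedge_step K L \<longleftrightarrow>
     (\<exists>v v1 v2. v \<in> \<Union>K \<and> v1 \<noteq> v2 \<and> v1 \<notin> \<Union>K \<and> v2 \<notin> \<Union>K \<and> L = wedge K v v1 v2)"


section \<open>Piecewise linear spheres\<close>

text \<open>
  The geometric realization lives in \<open>'a \<Rightarrow> real\<close> with pointwise linear structure and the
  product topology; only finitely many coordinates are involved, so this topology agrees
  there with the Euclidean one.
\<close>

instantiation "fun" :: (type, real_vector) real_vector
begin

definition scaleR_fun :: "real \<Rightarrow> ('a \<Rightarrow> 'b) \<Rightarrow> 'a \<Rightarrow> 'b" where
  "scaleR_fun c f = (\<lambda>x. c *\<^sub>R f x)"

instance
  by standard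
    (auto simp: scaleR_fun_def plus_fun_def fun_eq_iff scaleR_add_right scaleR_add_left)

end

text \<open>A geometric complex is represented by the vertex sets of its simplices.\<close>

definition geometric_complex :: "'p::real_vector set set \<Rightarrow> bool" where
  "geometric_complex T \<longleftrightarrow>
     finite T \<and>
     (\<forall>\<sigma>\<in>T. finite \<sigma> \<and> \<not> affine_dependent \<sigma>) \<and>
     (\<forall>\<sigma>\<in>T. \<forall>\<tau>. \<tau> \<subseteq> \<sigma> \<longrightarrow> \<tau> \<in> T) \<and>
     (\<forall>\<sigma>\<in>T. \<forall>\<tau>\<in>T. convex hull \<sigma> \<inter> convex hull \<tau> = convex hull (\<sigma> \<inter> \<tau>))"

definition underlying_space :: "'p::real_vector set set \<Rightarrow> 'p set" where
  "underlying_space T = (\<Union>\<sigma>\<in>T. convex hull \<sigma>)"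

definition affine_map_on :: "'p::real_vector set \<Rightarrow> ('p \<Rightarrow> 'q::real_vector) \<Rightarrow> bool" where
  "affine_map_on S f \<longleftrightarrow>
     (\<forall>x\<in>S. \<forall>y\<in>S. \<forall>t\<in>{0..1}.
        f ((1 - t) *\<^sub>R x + t *\<^sub>R y) = (1 - t) *\<^sub>R f x + t *\<^sub>R f y)"

definition pl_map_on :: "'p::real_vector set \<Rightarrow> ('p \<Rightarrow> 'q::real_vector) \<Rightarrow> bool" where
  "pl_map_on X f \<longleftrightarrow>
     (\<exists>T. geometric_complex T \<and> underlying_space T = X \<and>
          (\<forall>\<sigma>\<in>T. affine_map_on (convex hull \<sigma>) f))"

definition pl_homeomorphic ::
  "'p::{real_vector,topological_space} set \<Rightarrow> 'q::{real_vector,topological_space} set \<Rightarrow> bool" where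
  "pl_homeomorphic X Y \<longleftrightarrow>
     (\<exists>f g. homeomorphism X Y f g \<and> pl_map_on X f \<and> pl_map_on Y g)"

definition unit_point :: "'a \<Rightarrow> 'a \<Rightarrow> real" where
  "unit_point v = (\<lambda>w. if w = v then 1 else 0)"

definition geometric_realization :: "'a set set \<Rightarrow> ('a \<Rightarrow> real) set" where
  "geometric_realization K = underlying_space ((\<lambda>\<sigma>. unit_point ` \<sigma>) ` K)"

definition simplex_boundary :: "nat \<Rightarrow> nat set set" where
  "simplex_boundary d = {\<sigma>. \<sigma> \<subset> {0..d}}"

definition pl_sphere :: "'a set set \<Rightarrow> bool" where
  "pl_sphere K \<longleftrightarrow>
     simplicial_complex K \<and>
     (\<exists>d. pl_homeomorphic (geometric_realization K) (geometric_realization (simplex_boundary d)))"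

text \<open>
  Complexes are labelled by \<open>nat\<close>, so that fresh labels for the vertices created by a wedge are
  always available.
\<close>

definition seed :: "nat set set \<Rightarrow> bool" where
  "seed K \<longleftrightarrow>
     pl_sphere K \<and>
     \<not> (\<exists>L M :: nat set set. pl_sphere L \<and> complex_dim L < complex_dim K \<and>
             wedge_step\<^sup>+\<^sup>+ L M \<and> isomorphic_complexes M K)"


section \<open>Toric colorings\<close>

text \<open>
  Linear independence of the family \<open>\<lambda>(i)\<close>, \<open>i \<in> \<sigma>\<close>, is expressed by independence of its set of
  values together with injectivity on \<open>\<sigma>\<close>.
\<close>

definition integral_basis :: "nat \<Rightarrow> int vec set \<Rightarrow> bool" where
  "integral_basis n B \<longleftrightarrow>
     B \<subseteq> carrier_vec n \<and>
     \<not> LinearCombinations.module.lin_dep class_ring (module_vec TYPE(int) n) B \<and>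
     LinearCombinations.module.span class_ring (module_vec TYPE(int) n) B = carrier_vec n"

definition toric_coloring :: "nat \<Rightarrow> 'a set set \<Rightarrow> ('a \<Rightarrow> int vec) \<Rightarrow> bool" where
  "toric_coloring n K c \<longleftrightarrow>
     (\<forall>v\<in>\<Union>K. c v \<in> carrier_vec n) \<and>
     (\<forall>\<sigma>\<in>K. inj_on c \<sigma> \<and> (\<exists>B. c ` \<sigma> \<subseteq> B \<and> integral_basis n B))"

definition mod2_toric_coloring :: "nat \<Rightarrow> 'a set set \<Rightarrow> ('a \<Rightarrow> bit vec) \<Rightarrow> bool" where
  "mod2_toric_coloring n K c \<longleftrightarrow>
     (\<forall>v\<in>\<Union>K. c v \<in> carrier_vec n) \<and>
     (\<forall>\<sigma>\<in>K. inj_on c \<sigma> \<and>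
        \<not> LinearCombinations.module.lin_dep class_ring (module_vec TYPE(bit) n) (c ` \<sigma>))"

definition toric_colorable :: "'a set set \<Rightarrow> bool" where
  "toric_colorable K \<longleftrightarrow> (\<exists>c. toric_coloring (nat (complex_dim K + 1)) K c)"

definition mod2_toric_colorable :: "'a set set \<Rightarrow> bool" where
  "mod2_toric_colorable K \<longleftrightarrow> (\<exists>c. mod2_toric_coloring (nat (complex_dim K + 1)) K c)"

end

(*
  Proof idea. After a change of basis of F_2^5 all colours shall lie in a fixed set of 19 vectors any
  five of which have, read as 0/1 vectors over the integers, an even determinant or determinant
  -1, 0, 1. The determinants of facets are odd, because the facets are independent mod 2, so they are
  then 1 or -1. The complement of that set has twelve nonzero elements, and the required change of basis
  exists for every set X of at most ten vectors spanning F_2^5: some hyperplane misses at most four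
  elements of X; these have only three normal forms, and for each normal form there is a family of
  admissible positions of the twelve vectors, meeting the hyperplane in triples, such that the
  few elements of X in the hyperplane cannot hit all of these triples. That all facets have five
  vertices is a consequence of invariance of domain.
*)

theory Submission
  imports "HOL-Homology.Invariance_of_Domain" "Jordan_Normal_Form.DL_Rank" Defs
begin

section \<open>Purity of spheres\<close>

text \<open>Oddness alone does not suffice: a 0/1 determinant of order five can be 3 or 5 in
  absolute value, and whether a facet meets such a value depends on the basis of F_2^5 in which the
  colours are written. There are far too many ten-element sets X to treat one by one, so the check
  has to be uniform in X. The hyperplane achieves this: outside it X is known up to affine
  equivalence, and inside it only the number of elements of X is used. Every listed position has
  nine vectors off the hyperplane, which are compared with X explicitly, and three in it; what
  remains is a hitting set problem in the hyperplane. Purity matters because a facet with fewer than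
  five vertices would have no determinant to test.\<close>

lemma scaleR_fun_apply [simp]: "(c *\<^sub>R f) x = c *\<^sub>R (f x :: 'b::real_vector)"
  by (simp add: scaleR_fun_def)

lemma sum_fun_apply: "(\<Sum>a\<in>A. f a) x = (\<Sum>a\<in>A. f a x :: 'b::comm_monoid_add)"
  by (induction A rule: infinite_finite_induct) auto

lemma inj_unit_point: "inj unit_point"
  by (rule injI) (metis unit_point_def zero_neq_one)

lemma sum_unit_point:
  assumes "finite \<sigma>"
  shows "(\<Sum>a\<in>\<sigma>. u a *\<^sub>R unit_point a) = (\<lambda>v. if v \<in> \<sigma> then u v else 0 :: real)"
proof
  fix v
  have "(\<Sum>a\<in>\<sigma>. u a *\<^sub>R unit_point a) v = (\<Sum>a\<in>\<sigma>. if a = v then u a else 0)"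
    unfolding sum_fun_apply by (rule sum.cong) (auto simp: unit_point_def)
  then show "(\<Sum>a\<in>\<sigma>. u a *\<^sub>R unit_point a) v = (if v \<in> \<sigma> then u v else 0)"
    using assms by (simp add: sum.delta)
qed

text \<open>Unit points are coordinate vectors, so a point of the simplex is its own list of
  barycentric coordinates. All topology below is done with these coordinate conditions.\<close>

lemma convex_hull_unit_points:
  assumes "finite \<sigma>"
  shows "convex hull (unit_point ` \<sigma>) =
    {x. (\<forall>v. 0 \<le> x v) \<and> (\<forall>v. v \<notin> \<sigma> \<longrightarrow> x v = 0) \<and> sum x \<sigma> = (1 :: real)}" (is "_ = ?R")
proof -
  have "convex hull (unit_point ` \<sigma>) =
      {\<Sum>a\<in>\<sigma>. u a *\<^sub>R unit_point a |u. (\<forall>a\<in>\<sigma>. 0 \<le> u a) \<and> sum u \<sigma> = (1 :: real)}"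
  proof (intro equalityI subsetI)
    fix x assume "x \<in> convex hull (unit_point ` \<sigma>)"
    then obtain u where "\<forall>p\<in>unit_point ` \<sigma>. 0 \<le> u p" "sum u (unit_point ` \<sigma>) = 1"
        "(\<Sum>p\<in>unit_point ` \<sigma>. u p *\<^sub>R p) = x"
      using assms by (auto simp: convex_hull_finite)
    then show "x \<in> {\<Sum>a\<in>\<sigma>. u a *\<^sub>R unit_point a |u. (\<forall>a\<in>\<sigma>. 0 \<le> u a) \<and> sum u \<sigma> = 1}"
      by (intro CollectI exI[of _ "u \<circ> unit_point"])
         (auto simp: sum.reindex[OF inj_on_subset[OF inj_unit_point]])
  next
    fix x assume "x \<in> {\<Sum>a\<in>\<sigma>. u a *\<^sub>R unit_point a |u. (\<forall>a\<in>\<sigma>. 0 \<le> u a) \<and> sum u \<sigma> = (1 :: real)}"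
    then obtain u where u: "x = (\<Sum>a\<in>\<sigma>. u a *\<^sub>R unit_point a)" "\<And>a. a \<in> \<sigma> \<Longrightarrow> 0 \<le> u a" "sum u \<sigma> = 1"
      by blast
    show "x \<in> convex hull (unit_point ` \<sigma>)"
      unfolding u(1)
      by (rule convex_sum[OF assms convex_convex_hull u(3,2)]) (auto intro: hull_inc)
  qed
  also have "\<dots> = ?R"
  proof (intro equalityI subsetI)
    fix x assume "x \<in> ?R"
    then have "x = (\<Sum>a\<in>\<sigma>. x a *\<^sub>R unit_point a)"
      by (auto simp: sum_unit_point[OF assms])
    with \<open>x \<in> ?R\<close> show "x \<in> {\<Sum>a\<in>\<sigma>. u a *\<^sub>R unit_point a |u. (\<forall>a\<in>\<sigma>. 0 \<le> u a) \<and> sum u \<sigma> = 1}"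
      by blast
  qed (auto simp: sum_unit_point[OF assms])
  finally show ?thesis .
qed

definition open_simplex :: "'a set \<Rightarrow> ('a \<Rightarrow> real) set" where
  "open_simplex \<sigma> = {x \<in> convex hull (unit_point ` \<sigma>). \<forall>v\<in>\<sigma>. 0 < x v}"

text \<open>\<open>Euclidean_space n\<close> consists of the functions on \<open>nat\<close>
  vanishing from \<open>n\<close> on, with the product topology. It is thus a subspace of a function
  type like those that hold realizations, and invariance of domain can be stated with
  \<open>open\<close> and \<open>continuous_on\<close>.\<close>

lemma Euclidean_space_top_of_set:
  "Euclidean_space n = top_of_set (topspace (Euclidean_space n))"
  unfolding topspace_Euclidean_space by (simp only: Euclidean_space_def euclidean_product_topology)

lemma openin_Euclidean_space_iff:
  "openin (Euclidean_space n) U \<longleftrightarrow> (\<exists>Q. open Q \<and> U = topspace (Euclidean_space n) \<inter> Q)"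
proof -
  have "openin (Euclidean_space n) U \<longleftrightarrow> openin (top_of_set (topspace (Euclidean_space n))) U"
    by (rule arg_cong[OF Euclidean_space_top_of_set])
  then show ?thesis by (simp only: openin_open)
qed

text \<open>
  An embedding of a nonempty open subset of an open \<open>l\<close>-simplex into a simplex of smaller dimension
  would, in barycentric coordinates, be an open map of \<open>\<real>\<^sup>l\<close> with image in a hyperplane.
\<close>

lemma card_le_of_embedding:
  fixes \<tau> :: "'a set" and \<sigma> :: "'b set" and g :: "('a \<Rightarrow> real) \<Rightarrow> ('b \<Rightarrow> real)"
  assumes fin: "finite \<tau>" "finite \<sigma>"
    and B: "B \<subseteq> open_simplex \<tau>" "B \<noteq> {}" "openin (top_of_set (open_simplex \<tau>)) B"
    and g: "continuous_on B g" "inj_on g B" "g ` B \<subseteq> convex hull (unit_point ` \<sigma>)"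
  shows "card \<tau> \<le> card \<sigma>"
proof (rule ccontr)
  assume less: "\<not> card \<tau> \<le> card \<sigma>"
  obtain y0 where y0: "y0 \<in> B" using B(2) by blast
  have ne: "\<sigma> \<noteq> {}" 
    using g(3) y0 by auto
  then have "0 < card \<sigma>" using fin(2) by (simp add: card_gt_0_iff)
  define k where "k = card \<sigma> - 1"
  define l where "l = card \<tau> - 1"
  have card: "card \<sigma> = Suc k" "card \<tau> = Suc l" and kl: "k < l"
    using less \<open>0 < card \<sigma>\<close> by (auto simp: k_def l_def)
  obtain s where s: "bij_betw s {..k} \<sigma>"
    using ex_bij_betw_nat_finite[OF fin(2)] card(1) by (auto simp: atLeast0LessThan lessThan_Suc_atMost)
  obtain t where t: "bij_betw t {..l} \<tau>"
    using ex_bij_betw_nat_finite[OF fin(1)] card(2) by (auto simp: atLeast0LessThan lessThan_Suc_atMost)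
  \<comment> \<open>The inverse of a barycentric chart: \<open>l\<close> free coordinates, the last
    one being forced by the sum 1.\<close>
  define e where "e y = (\<lambda>v. if v \<in> \<tau> then let i = the_inv_into {..l} t v in
      if i < l then y i else 1 - (\<Sum>i<l. y i) else 0)" for y :: "nat \<Rightarrow> real"
  have e_t: "e y (t i) = (if i < l then y i else 1 - (\<Sum>i<l. y i))" if "i \<le> l" for y i
    using that t by (auto simp: e_def Let_def the_inv_into_f_f bij_betw_def)
  have e_out: "e y v = 0" if "v \<notin> \<tau>" for y v using that by (simp add: e_def)
  have cont_e: "continuous_on UNIV e"
  proof (rule continuous_on_coordinatewise_then_product)
    fix v
    show "continuous_on UNIV (\<lambda>y. e y v)"
      unfolding e_def Let_def
      by (cases "v \<in> \<tau>"; cases "the_inv_into {..l} t v < l") (auto intro!: continuous_intros)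
  qed
  \<comment> \<open>The chart of the target drops the last barycentric coordinate and pads with
    zeros; it is injective on the simplex because the coordinates sum to 1.\<close>
  define c where "c x = (\<lambda>i. if i < k then x (s i) else 0 :: real)" for x :: "'b \<Rightarrow> real"
  have cont_c: "continuous_on UNIV c"
  proof (rule continuous_on_coordinatewise_then_product)
    fix i
    show "continuous_on UNIV (\<lambda>x. c x i)"
      unfolding c_def by (cases "i < k") (auto intro!: continuous_on_product_coordinates)
  qed
  have inj_c: "inj_on c (convex hull (unit_point ` \<sigma>))"
  proof (rule inj_onI)
    fix x y assume xy: "x \<in> convex hull (unit_point ` \<sigma>)" "y \<in> convex hull (unit_point ` \<sigma>)" "c x = c y"
    have eq: "x (s i) = y (s i)" if "i < k" for i
      using fun_cong[OF xy(3), of i] that by (simp add: c_def)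
    have sum: "x (s k) = 1 - (\<Sum>i<k. x (s i))" if "x \<in> convex hull (unit_point ` \<sigma>)" for x
    proof -
      have "1 = sum x \<sigma>" using that by (simp add: convex_hull_unit_points[OF fin(2)])
      also have "\<dots> = (\<Sum>i\<le>k. x (s i))" using sum.reindex_bij_betw[OF s, of x] by simp
      finally show ?thesis by (simp add: lessThan_Suc_atMost[symmetric])
    qed
    have "x (s k) = y (s k)" using sum[OF xy(1)] sum[OF xy(2)] eq by simp
    then have "x v = y v" if "v \<in> \<sigma>" for v
      using that eq s by (metis (no_types, lifting) atMost_iff bij_betw_def imageE le_neq_implies_less)
    moreover have "x v = y v" if "v \<notin> \<sigma>" for v
      using that xy by (simp add: convex_hull_unit_points[OF fin(2)])
    ultimately show "x = y" by (intro ext) blast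
  qed
  let ?E = "topspace (Euclidean_space l)"
  define U where "U = {y \<in> ?E. e y \<in> B}"
  obtain O' where O': "open O'" "B = open_simplex \<tau> \<inter> O'"
    using B(3) by (auto simp: openin_open)
  have sum_e: "sum (e y) \<tau> = 1" for y
  proof -
    have "sum (e y) \<tau> = (\<Sum>i\<le>l. e y (t i))" using sum.reindex_bij_betw[OF t, of "e y"] by simp
    also have "\<dots> = 1" by (simp add: lessThan_Suc_atMost[symmetric] e_t)
    finally show ?thesis .
  qed
  have e_in: "e y \<in> open_simplex \<tau> \<longleftrightarrow> (\<forall>v\<in>\<tau>. 0 < e y v)" for y
  proof
    assume pos: "\<forall>v\<in>\<tau>. 0 < e y v"
    then have "0 \<le> e y v" for v using e_out[of v y] by (cases "v \<in> \<tau>") (auto intro: less_imp_le)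
    then show "e y \<in> open_simplex \<tau>"
      using pos sum_e e_out by (simp add: open_simplex_def convex_hull_unit_points[OF fin(1)])
  qed (simp add: open_simplex_def)
  have "U = ?E \<inter> {y. (\<forall>v\<in>\<tau>. 0 < e y v) \<and> e y \<in> O'}"
    by (auto simp: U_def O'(2) e_in)
  moreover have "open {y. (\<forall>v\<in>\<tau>. 0 < e y v) \<and> e y \<in> O'}"
  proof -
    have "open (e -` O')" using O'(1) cont_e by (simp add: open_vimage)
    moreover have "open {y. 0 < e y v}" for v
      using cont_e by (intro open_Collect_less continuous_on_const) (rule continuous_on_product_then_coordinatewise)
    then have "open (\<Inter>v\<in>\<tau>. {y. 0 < e y v})" using fin(1) by (intro open_INT) auto
    moreover have "{y. (\<forall>v\<in>\<tau>. 0 < e y v) \<and> e y \<in> O'} = (\<Inter>v\<in>\<tau>. {y. 0 < e y v}) \<inter> (e -` O')"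
      by auto
    ultimately show ?thesis by (simp add: open_Int)
  qed
  ultimately have openU: "openin (Euclidean_space l) U"
    unfolding openin_Euclidean_space_iff by blast
  define h where "h = c \<circ> g \<circ> e"
  have "U \<noteq> {}"
  proof -
    define y where "y i = (if i < l then y0 (t i) else 0)" for i
    have y0': "y0 \<in> open_simplex \<tau>" using y0 B(1) by blast
    then have y0_sum: "sum y0 \<tau> = 1" "\<And>v. v \<notin> \<tau> \<Longrightarrow> y0 v = 0"
      by (auto simp: open_simplex_def convex_hull_unit_points[OF fin(1)])
    have "(\<Sum>i\<le>l. y0 (t i)) = 1" using sum.reindex_bij_betw[OF t, of y0] y0_sum by simp
    then have last: "y0 (t l) = 1 - (\<Sum>i<l. y0 (t i))" by (simp add: lessThan_Suc_atMost[symmetric])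
    have "e y (t i) = y0 (t i)" if "i \<le> l" for i
      using that last by (cases "i = l") (auto simp: e_t y_def)
    then have "e y v = y0 v" for v
      using t e_out y0_sum(2) by (cases "v \<in> \<tau>") (auto simp: bij_betw_def)
    then have "e y = y0" by blast
    then have "y \<in> U" using y0 by (simp add: U_def topspace_Euclidean_space y_def)
    then show ?thesis by blast
  qed
  have inj_e: "inj_on e ?E"
  proof (rule inj_onI)
    fix x y assume xy: "x \<in> ?E" "y \<in> ?E" "e x = e y"
    have "x i = y i" for i
      using e_t[of i x] e_t[of i y] xy by (cases "i < l") (auto simp: topspace_Euclidean_space)
    then show "x = y" by blast
  qed
  have inj_h: "inj_on h U"
    unfolding h_def
  proof (intro comp_inj_on)
    show "inj_on e U" by (rule inj_on_subset[OF inj_e]) (auto simp: U_def)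
    show "inj_on g (e ` U)" by (rule inj_on_subset[OF g(2)]) (auto simp: U_def)
    have "e ` U \<subseteq> B" by (auto simp: U_def)
    then show "inj_on c (g ` e ` U)" using g(3) by (intro inj_on_subset[OF inj_c]) blast
  qed
  have h_in: "h y \<in> ?E" "h y k = 0" for y
    using kl by (auto simp: h_def c_def topspace_Euclidean_space)
  have "continuous_on U h"
    unfolding h_def
  proof (intro continuous_on_compose)
    show "continuous_on U e" using cont_e continuous_on_subset by blast
    show "continuous_on (e ` U) g" by (rule continuous_on_subset[OF g(1)]) (auto simp: U_def)
    show "continuous_on (g ` e ` U) c" using cont_c continuous_on_subset by blast
  qed
  then have "continuous_map (top_of_set U) (top_of_set ?E) h"
    using h_in(1) by (simp add: continuous_map_in_subtopology image_subset_iff)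
  moreover have "top_of_set U = subtopology (top_of_set ?E) U"
    by (simp add: subtopology_subtopology U_def Int_absorb1)
  ultimately have "continuous_map (subtopology (Euclidean_space l) U) (Euclidean_space l) h"
    using Euclidean_space_top_of_set[of l] by metis
  then have "openin (Euclidean_space l) (h ` U)"
    using invariance_of_domain_Euclidean_space[OF openU] inj_h by blast
  then obtain S where S: "open S" "h ` U = ?E \<inter> S"
    unfolding openin_Euclidean_space_iff by blast
  obtain z where z: "z \<in> h ` U" using \<open>U \<noteq> {}\<close> by blast
  \<comment> \<open>The image of \<open>h\<close> lies where coordinate \<open>k\<close> vanishes.
    As \<open>k < l\<close>, this is a true direction of the source space, and moving along it
    leaves the image, against openness.\<close>
  define p where "p r = (\<lambda>i. if i = k then r else z i)" for r :: real
  have "continuous_on UNIV p"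
  proof (rule continuous_on_coordinatewise_then_product)
    fix i
    show "continuous_on UNIV (\<lambda>r. p r i)"
      unfolding p_def by (cases "i = k") (auto intro!: continuous_intros)
  qed
  then have "open (p -` S)" using S(1) by (simp add: open_vimage)
  moreover have "p 0 = z" using z h_in(2) by (auto simp: p_def)
  then have "0 \<in> p -` S" using z S(2) by auto
  ultimately obtain \<epsilon> where \<epsilon>: "\<epsilon> > 0" "ball 0 \<epsilon> \<subseteq> p -` S"
    by (meson openE)
  then have "\<epsilon> / 2 \<in> ball (0 :: real) \<epsilon>" by simp
  then have "p (\<epsilon> / 2) \<in> S" using \<epsilon>(2) by blast
  moreover have "p (\<epsilon> / 2) \<in> ?E"
    using z h_in(1) kl by (auto simp: p_def topspace_Euclidean_space)
  ultimately have "p (\<epsilon> / 2) \<in> h ` U" using S(2) by blast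
  then have "p (\<epsilon> / 2) k = 0" using h_in(2) by auto
  then show False using \<epsilon>(1) by (simp add: p_def)
qed

section \<open>Open facets of a complex and the size of facets of a sphere\<close>

lemma open_simplex_subset: "open_simplex \<sigma> \<subseteq> convex hull (unit_point ` \<sigma>)"
  by (auto simp: open_simplex_def)

lemma geometric_realization_eq:
  "geometric_realization K = (\<Union>\<sigma>\<in>K. convex hull (unit_point ` \<sigma>))"
  by (simp add: geometric_realization_def underlying_space_def)

lemma simplicial_complex_finite_face:
  assumes "simplicial_complex K" "\<sigma> \<in> K"
  shows "finite \<sigma>"
  using assms by (meson Union_upper finite_subset simplicial_complex_def)

text \<open>A point with positive coordinates on \<open>\<sigma>\<close> can only lie in simplices
  containing \<open>\<sigma>\<close>, and by maximality that is \<open>\<sigma>\<close> alone. So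
  finitely many strict inequalities cut out the open facet.\<close>

lemma openin_open_simplex_facet:
  assumes K: "simplicial_complex K" and \<sigma>: "\<sigma> \<in> facets K"
  shows "openin (top_of_set (geometric_realization K)) (open_simplex \<sigma>)"
proof -
  have fin: "finite \<sigma>" and "\<sigma> \<in> K"
    using simplicial_complex_finite_face[OF K] \<sigma> by (auto simp: facets_def)
  have "open_simplex \<sigma> = geometric_realization K \<inter> (\<Inter>v\<in>\<sigma>. {x. 0 < x v})"
  proof (intro equalityI subsetI)
    fix x assume "x \<in> open_simplex \<sigma>"
    then show "x \<in> geometric_realization K \<inter> (\<Inter>v\<in>\<sigma>. {x. 0 < x v})"
      using \<open>\<sigma> \<in> K\<close> by (auto simp: open_simplex_def geometric_realization_eq)
  next
    fix x assume "x \<in> geometric_realization K \<inter> (\<Inter>v\<in>\<sigma>. {x. 0 < x v})"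
    then obtain \<tau> where \<tau>: "\<tau> \<in> K" "x \<in> convex hull (unit_point ` \<tau>)" and pos: "\<forall>v\<in>\<sigma>. 0 < x v"
      by (auto simp: geometric_realization_eq)
    then have "\<forall>v. v \<notin> \<tau> \<longrightarrow> x v = 0"
      by (simp add: convex_hull_unit_points[OF simplicial_complex_finite_face[OF K \<tau>(1)]])
    with pos have "\<sigma> \<subseteq> \<tau>" by fastforce
    then have "\<tau> = \<sigma>" using \<sigma> \<tau>(1) by (auto simp: facets_def)
    then show "x \<in> open_simplex \<sigma>" using \<tau> pos by (simp add: open_simplex_def)
  qed
  moreover have "open {x :: 'a \<Rightarrow> real. 0 < x v}" for v
    by (intro open_Collect_less continuous_on_const continuous_on_product_coordinates)
  then have "open (\<Inter>v\<in>\<sigma>. {x :: 'a \<Rightarrow> real. 0 < x v})" using fin by (intro open_INT) auto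
  ultimately show ?thesis by (auto simp: openin_open)
qed

text \<open>A small move towards the barycenter makes every coordinate on \<open>\<sigma>\<close>
  positive.\<close>

lemma open_simplex_dense:
  assumes \<sigma>: "finite \<sigma>" and x: "x \<in> convex hull (unit_point ` \<sigma>)" and S: "open S" "x \<in> S"
  shows "open_simplex \<sigma> \<inter> S \<noteq> {}"
proof -
  have "\<sigma> \<noteq> {}" using x by auto
  then have card: "0 < card \<sigma>" using \<sigma> by (simp add: card_gt_0_iff)
  define b where "b v = (if v \<in> \<sigma> then 1 / card \<sigma> else 0 :: real)" for v
  define p where "p r = (\<lambda>v. (1 - r) * x v + r * b v)" for r :: real
  have "continuous_on UNIV p"
    unfolding p_def by (rule continuous_on_coordinatewise_then_product) (auto intro!: continuous_intros)
  then have "open (p -` S)" using S(1) by (simp add: open_vimage)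
  moreover have "0 \<in> p -` S" using S(2) by (simp add: p_def)
  ultimately obtain \<epsilon> where \<epsilon>: "\<epsilon> > 0" "ball 0 \<epsilon> \<subseteq> p -` S" by (meson openE)
  define r where "r = min (\<epsilon> / 2) (1 / 2)"
  have r: "0 < r" "r < 1" "r \<in> ball 0 \<epsilon>" using \<epsilon>(1) by (auto simp: r_def)
  have "p r \<in> S" using \<epsilon>(2) r(3) by blast
  moreover have "p r \<in> open_simplex \<sigma>"
  proof -
    have x': "\<forall>v. 0 \<le> x v" "\<forall>v. v \<notin> \<sigma> \<longrightarrow> x v = 0" "sum x \<sigma> = 1"
      using x by (auto simp: convex_hull_unit_points[OF \<sigma>])
    have "sum (p r) \<sigma> = (1 - r) * sum x \<sigma> + r * sum b \<sigma>"
      by (simp add: p_def sum.distrib sum_distrib_left)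
    also have "sum b \<sigma> = 1" using card by (simp add: b_def)
    finally have "sum (p r) \<sigma> = 1" using x'(3) by simp
    moreover have "0 < p r v" if "v \<in> \<sigma>" for v
      using that x'(1) r card by (auto simp: p_def b_def intro!: add_nonneg_pos mult_nonneg_nonneg)
    moreover have "p r v = 0" if "v \<notin> \<sigma>" for v
      using that x'(2) by (simp add: p_def b_def)
    moreover from calculation have "0 \<le> p r v" for v
      by (cases "v \<in> \<sigma>") (auto intro: less_imp_le)
    ultimately show ?thesis
      by (simp add: open_simplex_def convex_hull_unit_points[OF \<sigma>])
  qed
  ultimately show ?thesis by blast
qed

lemma simplicial_complex_simplex_boundary: "simplicial_complex (simplex_boundary d)"
proof -
  have "\<Union> (simplex_boundary d) \<subseteq> {0..d}" by (auto simp: simplex_boundary_def)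
  then show ?thesis
    unfolding simplicial_complex_def by (auto simp: simplex_boundary_def finite_subset)
qed

text \<open>The open facet has an open image in the model sphere, which meets the interior of some
  facet \<open>\<tau>\<close> with \<open>d\<close> vertices. On the overlap \<open>g\<close> embeds
  an open piece of \<open>\<tau>\<close> into \<open>\<sigma>\<close> and \<open>f\<close> embeds
  its image back, so neither dimension exceeds the other.\<close>

lemma card_facet_of_sphere:
  assumes K: "simplicial_complex K"
    and h: "homeomorphism (geometric_realization K) (geometric_realization (simplex_boundary d)) f g"
    and \<sigma>: "\<sigma> \<in> facets K" "\<sigma> \<noteq> {}"
  shows "card \<sigma> = d"
proof -
  let ?K = "geometric_realization K" and ?L = "geometric_realization (simplex_boundary d)"
  have fin: "finite \<sigma>" and "\<sigma> \<in> K"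
    using simplicial_complex_finite_face[OF K] \<sigma> by (auto simp: facets_def)
  have "(\<lambda>v. if v \<in> \<sigma> then 1 / card \<sigma> else 0) \<in> open_simplex \<sigma>"
    using fin \<sigma>(2) by (simp add: open_simplex_def convex_hull_unit_points card_gt_0_iff)
  then obtain x where x: "x \<in> open_simplex \<sigma>" by blast
  have openK: "openin (top_of_set ?K) (open_simplex \<sigma>)"
    by (rule openin_open_simplex_facet[OF K \<sigma>(1)])
  then have subK: "open_simplex \<sigma> \<subseteq> ?K" by (rule openin_imp_subset)
  have "openin (top_of_set ?L) (f ` open_simplex \<sigma>)"
    using homeomorphism_imp_open_map[OF h openK] .
  then obtain S where S: "open S" "f ` open_simplex \<sigma> = ?L \<inter> S" by (auto simp: openin_open)
  have fx: "f x \<in> ?L" "f x \<in> S" using x S(2) by blast+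
  then obtain \<rho> where "\<rho> \<subset> {0..d}" "f x \<in> convex hull (unit_point ` \<rho>)"
    by (auto simp: geometric_realization_eq simplex_boundary_def)
  then obtain j where j: "j \<in> {0..d}" "\<rho> \<subseteq> {0..d} - {j}" by blast
  \<comment> \<open>The facet opposite to a vertex \<open>j\<close> that the face carrying
    \<open>f x\<close> misses. Since \<open>f x\<close> may lie on its boundary, density is needed
    to find interior points of \<open>\<tau>\<close> in \<open>S\<close>.\<close>
  define \<tau> where "\<tau> = {0..d} - {j}"
  have card_\<tau>: "card \<tau> = d" and fin_\<tau>: "finite \<tau>" using j(1) by (simp_all add: \<tau>_def)
  have \<tau>: "\<tau> \<in> facets (simplex_boundary d)"
    unfolding facets_def simplex_boundary_def
  proof (intro CollectI conjI ballI impI)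
    show "\<tau> \<subset> {0..d}" using j(1) unfolding \<tau>_def by blast
    fix \<rho> assume "\<rho> \<in> {\<sigma>. \<sigma> \<subset> {0..d}}" "\<tau> \<subseteq> \<rho>"
    then show "\<rho> = \<tau>" using j(1) unfolding \<tau>_def by blast
  qed
  have "f x \<in> convex hull (unit_point ` \<tau>)"
    using \<open>f x \<in> convex hull _\<close> hull_mono[OF image_mono[OF j(2)], of convex unit_point]
    unfolding \<tau>_def by blast
  then have "open_simplex \<tau> \<inter> S \<noteq> {}"
    using open_simplex_dense[OF fin_\<tau> _ S(1) fx(2)] by blast
  have openL: "openin (top_of_set ?L) (open_simplex \<tau>)"
    by (rule openin_open_simplex_facet[OF simplicial_complex_simplex_boundary \<tau>])
  then have subL: "open_simplex \<tau> \<subseteq> ?L" by (rule openin_imp_subset)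
  define B where "B = open_simplex \<tau> \<inter> S"
  have B: "B \<subseteq> open_simplex \<tau>" "B \<noteq> {}" "B \<subseteq> f ` open_simplex \<sigma>"
    using \<open>open_simplex \<tau> \<inter> S \<noteq> {}\<close> S(2) subL by (auto simp: B_def)
  have gB: "g ` B \<subseteq> open_simplex \<sigma>"
    using B(3) homeomorphism_apply1[OF h] subK by force
  have openB: "openin (top_of_set ?L) B"
    using openL S(1) unfolding B_def by (metis openin_Int_open)
  have "card \<tau> \<le> card \<sigma>"
  proof (rule card_le_of_embedding[OF fin_\<tau> fin B(1,2)])
    show "openin (top_of_set (open_simplex \<tau>)) B" using S(1) by (auto simp: B_def openin_open)
    show "continuous_on B g"
      using h B(1) subL by (meson continuous_on_subset homeomorphism_def)
    show "inj_on g B"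
      using homeomorphism_apply2[OF h] B(1) subL by (intro inj_on_inverseI[of _ f]) auto
    show "g ` B \<subseteq> convex hull (unit_point ` \<sigma>)" using gB open_simplex_subset by blast
  qed
  moreover have "card \<sigma> \<le> card \<tau>"
  proof (rule card_le_of_embedding[OF fin fin_\<tau> gB])
    show "g ` B \<noteq> {}" using B(2) by blast
    have "openin (top_of_set ?K) (g ` B)"
      using homeomorphism_imp_open_map[OF _ openB] h by (meson homeomorphism_symD)
    then show "openin (top_of_set (open_simplex \<sigma>)) (g ` B)"
      using gB subK by (meson openin_subset_trans)
    show "continuous_on (g ` B) f"
      using h gB subK by (meson continuous_on_subset homeomorphism_def)
    show "inj_on f (g ` B)"
      using homeomorphism_apply1[OF h] gB subK by (intro inj_on_inverseI[of _ g]) auto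
    show "f ` g ` B \<subseteq> convex hull (unit_point ` \<tau>)"
      using homeomorphism_apply2[OF h] B(1) subL open_simplex_subset[of \<tau>] by force
  qed
  ultimately show ?thesis using card_\<tau> by simp
qed

lemma finite_simplicial_complex: "simplicial_complex K \<Longrightarrow> finite K"
  by (meson Pow_iff Union_upper finite_Pow_iff finite_subset simplicial_complex_def subsetI)

lemma face_in_facet:
  assumes K: "simplicial_complex K" and "\<sigma> \<in> K"
  obtains \<tau> where "\<tau> \<in> facets K" "\<sigma> \<subseteq> \<tau>"
proof -
  have "finite {\<tau> \<in> K. \<sigma> \<subseteq> \<tau>}" using finite_simplicial_complex[OF K] by simp
  moreover have "\<sigma> \<in> {\<tau> \<in> K. \<sigma> \<subseteq> \<tau>}" using assms(2) by simp
  ultimately obtain \<tau> where "\<tau> \<in> {\<tau> \<in> K. \<sigma> \<subseteq> \<tau>}" "\<forall>\<rho>\<in>{\<tau> \<in> K. \<sigma> \<subseteq> \<tau>}. \<tau> \<subseteq> \<rho> \<longrightarrow> \<tau> = \<rho>"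
    using finite_has_maximal2[of "{\<tau> \<in> K. \<sigma> \<subseteq> \<tau>}" \<sigma>] by blast
  then show thesis by (intro that[of \<tau>]) (auto simp: facets_def)
qed

text \<open>The index \<open>d\<close> of the model sphere is unknown; a face of maximal size is a
  facet and forces \<open>d = Suc n\<close>, which then holds for all facets.\<close>

lemma pl_sphere_pure:
  assumes K: "pl_sphere K" and dim: "complex_dim K = int n" and \<sigma>: "\<sigma> \<in> facets K"
  shows "card \<sigma> = Suc n"
proof -
  obtain d f g where sc: "simplicial_complex K"
    and h: "homeomorphism (geometric_realization K) (geometric_realization (simplex_boundary d)) f g"
    using K by (auto simp: pl_sphere_def pl_homeomorphic_def)
  have "finite K" "K \<noteq> {}"
    using finite_simplicial_complex[OF sc] sc by (auto simp: simplicial_complex_def)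
  then have "Max (card ` K) \<in> card ` K" by (intro Max_in) auto
  then obtain \<rho> where \<rho>: "\<rho> \<in> K" "card \<rho> = Max (card ` K)" by auto
  then have card_\<rho>: "card \<rho> = Suc n" using dim by (simp add: complex_dim_def)
  have "\<rho> \<in> facets K"
    unfolding facets_def
  proof (intro CollectI conjI ballI impI)
    fix \<tau> assume \<tau>: "\<tau> \<in> K" "\<rho> \<subseteq> \<tau>"
    then have "card \<tau> \<le> card \<rho>" using \<rho> \<open>finite K\<close> by simp
    then show "\<tau> = \<rho>"
      using \<tau> simplicial_complex_finite_face[OF sc \<tau>(1)] by (metis card_seteq)
  qed (rule \<rho>(1))
  moreover have "\<rho> \<noteq> {}" using card_\<rho> by auto
  ultimately have "d = Suc n" using card_facet_of_sphere[OF sc h] card_\<rho> by blast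
  moreover have "\<sigma> \<noteq> {}" using \<sigma> \<rho>(1) \<open>\<rho> \<noteq> {}\<close> by (auto simp: facets_def)
  ultimately show ?thesis using card_facet_of_sphere[OF sc h \<sigma>] by blast
qed

section \<open>Bases of elementary abelian 2-groups\<close>

text \<open>Scalars of F_2 are Booleans, so a linear combination is a subset sum and makes sense in
  any abelian group. Lists of unequal length are cut at the shorter one.\<close>

fun comb :: "'v::ab_group_add list \<Rightarrow> bool list \<Rightarrow> 'v" where
  "comb (v # vs) (k # ks) = (if k then v + comb vs ks else comb vs ks)"
| "comb _ _ = 0"

definition indep :: "'v::ab_group_add list \<Rightarrow> bool" where
  "indep vs \<longleftrightarrow> (\<forall>ks. length ks = length vs \<longrightarrow> comb vs ks = 0 \<longrightarrow> True \<notin> set ks)"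

definition codes :: "nat \<Rightarrow> bool list set" where
  "codes n = {ks. length ks = n}"

definition xor_list :: "bool list \<Rightarrow> bool list \<Rightarrow> bool list" where
  "xor_list = map2 (\<noteq>)"

lemma length_xor_list [simp]: "length (xor_list ks ls) = min (length ks) (length ls)"
  by (simp add: xor_list_def)

text \<open>The executable counterpart of \<open>comb\<close> for vectors given by their
  coordinates; \<open>n\<close> is passed to provide the zero vector.\<close>

fun comb_codes :: "nat \<Rightarrow> bool list list \<Rightarrow> bool list \<Rightarrow> bool list" where
  "comb_codes n (p # ps) (k # ks) =
     (if k then xor_list p (comb_codes n ps ks) else comb_codes n ps ks)"
| "comb_codes n _ _ = replicate n False"

lemma finite_codes [simp]: "finite (codes n)"
  and card_codes: "card (codes n) = 2 ^ n"
proof -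
  have "codes n = {ks. set ks \<subseteq> UNIV \<and> length ks = n}" by (simp add: codes_def)
  then show "finite (codes n)" "card (codes n) = 2 ^ n"
    using finite_lists_length_eq[of "UNIV :: bool set" n] card_lists_length_eq[of "UNIV :: bool set" n]
    by simp_all
qed

lemma length_comb_codes:
  "\<forall>p\<in>set ps. length p = n \<Longrightarrow> length (comb_codes n ps ks) = n"
  by (induction n ps ks rule: comb_codes.induct) auto

lemma comb_replicate_False [simp]: "comb vs (replicate n False) = 0"
proof (induction vs arbitrary: n)
  case (Cons v vs)
  then show ?case by (cases n) auto
qed simp

locale boolean_group =
  fixes V :: "'v::{ab_group_add, finite} itself"
  assumes double [simp]: "v + v = (0 :: 'v)"
begin

lemma double' [simp]: "v + (v + w) = (w :: 'v)"
  by (simp flip: add.assoc)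

lemma add_eq_0_iff: "v + w = 0 \<longleftrightarrow> v = (w :: 'v)"
  by (metis add.right_neutral double double')

lemma comb_xor_list:
  fixes vs :: "'v list"
  assumes "length ks = length vs" "length ls = length vs"
  shows "comb vs (xor_list ks ls) = comb vs ks + comb vs ls"
  using assms
proof (induction vs arbitrary: ks ls)
  case (Cons v vs)
  then obtain k ks' l ls' where "ks = k # ks'" "ls = l # ls'"
    by (metis length_Suc_conv list.size(4) Suc_eq_plus1)
  with Cons show ?case by (auto simp: xor_list_def ac_simps)
qed simp

text \<open>Change of basis: coordinates relative to the vectors coded by \<open>ps\<close> become
  coordinates relative to \<open>vs\<close>. This reduces questions about the abstract group to
  evaluation on codes.\<close>

lemma comb_map_comb:
  fixes vs :: "'v list"
  assumes "\<forall>p\<in>set ps. length p = length vs"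
  shows "comb (map (comb vs) ps) ks = comb vs (comb_codes (length vs) ps ks)"
  using assms
  by (induction "length vs" ps ks rule: comb_codes.induct)
     (auto simp: comb_xor_list length_comb_codes)

lemma inj_on_comb:
  fixes vs :: "'v list"
  assumes "indep vs"
  shows "inj_on (comb vs) (codes (length vs))"
proof (rule inj_onI)
  fix ks ls assume *: "ks \<in> codes (length vs)" "ls \<in> codes (length vs)" "comb vs ks = comb vs ls"
  then have len: "length ks = length vs" "length ls = length vs" by (auto simp: codes_def)
  with * have "comb vs (xor_list ks ls) = 0" by (simp add: comb_xor_list)
  then have "True \<notin> set (xor_list ks ls)" using assms len by (simp add: indep_def)
  show "ks = ls"
  proof (rule nth_equalityI)
    fix i assume "i < length ks"
    with len have "xor_list ks ls ! i \<longleftrightarrow> ks ! i \<noteq> ls ! i"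
      by (simp add: xor_list_def)
    moreover from len \<open>i < length ks\<close> have "xor_list ks ls ! i \<in> set (xor_list ks ls)"
      by (intro nth_mem) simp
    ultimately show "ks ! i = ls ! i" using \<open>True \<notin> set (xor_list ks ls)\<close> by auto
  qed (simp add: len)
qed

lemma indep_Cons:
  fixes vs :: "'v list"
  shows "indep (v # vs) \<longleftrightarrow> indep vs \<and> v \<notin> comb vs ` codes (length vs)"
proof
  assume *: "indep (v # vs)"
  have "indep vs"
    unfolding indep_def
  proof (intro allI impI)
    fix ks assume "length ks = length vs" "comb vs ks = 0"
    then show "True \<notin> set ks" using *[unfolded indep_def, rule_format, of "False # ks"] by simp
  qed
  moreover have "v \<notin> comb vs ` codes (length vs)"
  proof
    assume "v \<in> comb vs ` codes (length vs)"
    then obtain ks where "length ks = length vs" "v = comb vs ks" by (auto simp: codes_def)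
    then show False using *[unfolded indep_def, rule_format, of "True # ks"] by simp
  qed
  ultimately show "indep vs \<and> v \<notin> comb vs ` codes (length vs)" by blast
next
  assume *: "indep vs \<and> v \<notin> comb vs ` codes (length vs)"
  show "indep (v # vs)"
    unfolding indep_def
  proof (intro allI impI)
    fix ks assume "length ks = length (v # vs)" "comb (v # vs) ks = 0"
    then obtain k ls where "ks = k # ls" "length ls = length vs" by (auto simp: length_Suc_conv)
    with * \<open>comb (v # vs) ks = 0\<close> show "True \<notin> set ks"
      by (cases k) (auto simp: add_eq_0_iff codes_def indep_def)
  qed
qed

lemma indep_Nil [simp]: "indep ([] :: 'v list)"
  by (simp add: indep_def)

lemma bij_betw_comb:
  fixes vs :: "'v list"
  assumes "indep vs" "card (UNIV :: 'v set) = 2 ^ length vs"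
  shows "bij_betw (comb vs) (codes (length vs)) UNIV"
  unfolding bij_betw_def
  using inj_on_comb[OF assms(1)] assms(2)
  by (metis card_codes card_image card_subset_eq finite_class.finite_UNIV top_greatest)

text \<open>A linear functional to F_2 written as a predicate; exclusive or is the addition of F_2.
  If it is not constantly false, its kernel is a hyperplane.\<close>

definition additive_test :: "('v \<Rightarrow> bool) \<Rightarrow> bool" where
  "additive_test f \<longleftrightarrow> (\<forall>v w. f (v + w) \<longleftrightarrow> f v \<noteq> f w)"

lemma additive_test_0: "additive_test f \<Longrightarrow> \<not> f 0"
  unfolding additive_test_def by (metis add_0)

lemma additive_test_comb:
  assumes "additive_test f" "\<forall>v\<in>set vs. \<not> f v"
  shows "\<not> f (comb vs ks)"
  using assms(2) by (induction vs ks rule: comb.induct)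
    (use assms(1) additive_test_0[OF assms(1)] in \<open>auto simp: additive_test_def\<close>)

text \<open>Translation by \<open>t\<close> exchanges the kernel and its complement.\<close>

lemma card_kernel:
  assumes f: "additive_test f" and t: "f t"
  shows "2 * card {v. \<not> f v} = card (UNIV :: 'v set)"
proof -
  have "bij_betw (\<lambda>v. v + t) {v. \<not> f v} {v. f v}"
    by (rule bij_betw_byWitness[where f' = "\<lambda>v. v + t"])
       (use f t in \<open>auto simp: additive_test_def add.assoc\<close>)
  then have "card {v. \<not> f v} = card {v. f v}" by (rule bij_betw_same_card)
  moreover have "card (UNIV :: 'v set) = card ({v. \<not> f v} \<union> {v. f v})"
    by (rule arg_cong[where f = card]) auto
  moreover have "card ({v. \<not> f v} \<union> {v. f v}) = card {v. \<not> f v} + card {v. f v}"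
    by (rule card_Un_disjoint) auto
  ultimately show ?thesis by simp
qed

text \<open>Counting replaces dimension theory: the span has at most \<open>2 ^ length vs\<close>
  elements, while the kernel is half of the group.\<close>

lemma extend_indep_in_kernel:
  assumes f: "additive_test f" and t: "f t" and vs: "indep vs"
    and len: "2 ^ Suc (length vs) < card (UNIV :: 'v set)"
  obtains d where "\<not> f d" "indep (d # vs)"
proof -
  have "card (comb vs ` codes (length vs)) \<le> 2 ^ length vs"
    using card_image_le[OF finite_codes, of "comb vs"] by (simp add: card_codes)
  also have "\<dots> < card {v. \<not> f v}" using card_kernel[OF f t] len by simp
  finally have "\<not> {v. \<not> f v} \<subseteq> comb vs ` codes (length vs)"
    by (meson card_mono finite_imageI finite_codes leD)
  then show thesis using that vs by (auto simp: indep_Cons)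
qed

end

section \<open>Configurations of forbidden vectors\<close>

text \<open>
  Vectors of \<open>F\<^sub>2\<^sup>5\<close> are written as binary numbers, most significant bit first; the forbidden ones are
  3, 11, 12, 17--23, 27, 28. With \<open>p, q, r, s, x\<close> denoting 3, 11, 12, 9, 16 they are
  \<open>p\<close>, \<open>q\<close>, \<open>r\<close>, \<open>x+p\<close>, \<open>x+q\<close>, \<open>x+r\<close>, \<open>x+q+r\<close>, \<open>x+p+q+r\<close>, \<open>x+s+q\<close>, \<open>x+s+r\<close>,
  \<open>x+s+p+q\<close>, \<open>x+s+p+r\<close>. Their complement is the largest set of 0/1 vectors found by random
  search among those containing no five vectors of determinant \<open>\<plusminus>3\<close> or \<open>\<plusminus>5\<close>.
\<close>

definition forbidden_codes :: "bool list list" where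
  "forbidden_codes =
    [[False, False, False, True, True],
     [False, True, False, True, True],
     [False, True, True, False, False],
     [True, False, False, False, True],
     [True, False, False, True, False],
     [True, False, False, True, True],
     [True, False, True, False, False],
     [True, False, True, False, True],
     [True, False, True, True, False],
     [True, False, True, True, True],
     [True, True, False, True, True],
     [True, True, True, False, False]]"

text \<open>
  A refutation search for a set of at most \<open>b\<close> elements that meets every member of the family,
  branching on whether it contains the first element of the first member.
\<close>

function unhittable :: "'a list list \<Rightarrow> nat \<Rightarrow> bool" where
  "unhittable [] b \<longleftrightarrow> False"
| "unhittable ([] # F) b \<longleftrightarrow> True"
| "unhittable ((v # s) # F) 0 \<longleftrightarrow> True"
| "unhittable ((v # s) # F) (Suc b) \<longleftrightarrow>
     unhittable (filter (\<lambda>t. v \<notin> set t) F) b \<and>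
     unhittable (s # map (removeAll v) (filter (\<lambda>t. v \<in> set t) F) @ filter (\<lambda>t. v \<notin> set t) F) (Suc b)"
  by pat_completeness auto

termination unhittable
proof (relation "measure (\<lambda>(F, b). \<Sum>t\<leftarrow>F. Suc (length t))")
  fix v :: 'a and s F and b :: nat
  show "((filter (\<lambda>t. v \<notin> set t) F, b), (v # s) # F, Suc b) \<in> measure (\<lambda>(F, b). \<Sum>t\<leftarrow>F. Suc (length t))"
    using sum_list_filter_le_nat[of "\<lambda>t. Suc (length t)" "\<lambda>t. v \<notin> set t" F]
    by simp
  have "(\<Sum>t\<leftarrow>filter (\<lambda>t. v \<in> set t) F. Suc (length (removeAll v t))) +
      (\<Sum>t\<leftarrow>filter (\<lambda>t. v \<notin> set t) F. Suc (length t)) \<le> (\<Sum>t\<leftarrow>F. Suc (length t))"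
  proof (induction F)
    case (Cons t F)
    then show ?case using add_mono[OF length_removeAll_less_eq[of v t] Cons.IH] by (auto simp: add.assoc)
  qed simp
  then show "((s # map (removeAll v) (filter (\<lambda>t. v \<in> set t) F) @ filter (\<lambda>t. v \<notin> set t) F, Suc b),
      (v # s) # F, Suc b) \<in> measure (\<lambda>(F, b). \<Sum>t\<leftarrow>F. Suc (length t))"
    by (simp add: comp_def)
qed simp

text \<open>If \<open>v\<close> is in \<open>Y\<close>, it uses up one unit of the budget and only
  members without \<open>v\<close> are left to hit. If not, deleting \<open>v\<close> from a member
  does not change its intersection with \<open>Y\<close>.\<close>

lemma unhittable_sound:
  assumes "unhittable F b" "finite Y" "card Y \<le> b"
  shows "\<exists>s\<in>set F. set s \<inter> Y = {}"
  using assms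
proof (induction F b arbitrary: Y rule: unhittable.induct)
  case (4 v s F b)
  show ?case
  proof (cases "v \<in> Y")
    case True
    with 4(4,5) have "card (Y - {v}) \<le> b" by auto
    with 4(3,4) obtain t where "t \<in> set F" "v \<notin> set t" "set t \<inter> (Y - {v}) = {}"
      using "4.IH"(1)[of "Y - {v}"] by auto
    then show ?thesis by auto
  next
    case False
    with 4(3-5) obtain t where "t \<in> set (s # map (removeAll v) (filter (\<lambda>t. v \<in> set t) F) @
        filter (\<lambda>t. v \<notin> set t) F)" "set t \<inter> Y = {}"
      using "4.IH"(2)[of Y] by auto
    then consider "t \<in> set (s # F)" | u where "u \<in> set F" "t = removeAll v u" by auto
    then show ?thesis
    proof cases
      case 1
      with \<open>set t \<inter> Y = {}\<close> False show ?thesis by auto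
    next
      case 2
      with \<open>set t \<inter> Y = {}\<close> False have "set u \<inter> Y = {}" by auto
      with 2 show ?thesis by auto
    qed
  qed
qed auto

text \<open>Here \<open>ps\<close> are the coordinates of a candidate basis in a basis whose first
  vector alone lies off the hyperplane, so the head of a code tells on which side a vector lies. The
  conditions are independence, tested on all coefficient lists, and that forbidden vectors off the
  hyperplane avoid \<open>T\<close>.\<close>

definition compatible :: "bool list list \<Rightarrow> bool list list \<Rightarrow> bool" where
  "compatible T ps \<longleftrightarrow> length ps = 5 \<and> list_all (\<lambda>p. length p = 5) ps \<and>
     list_all (\<lambda>ks. True \<in> set ks \<longrightarrow> comb_codes 5 ps ks \<noteq> replicate 5 False)
       (List.n_lists 5 [False, True]) \<and>
     list_all (\<lambda>w. hd (comb_codes 5 ps w) \<longrightarrow> comb_codes 5 ps w \<notin> set T) forbidden_codes"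

text \<open>In every listed basis only the first vector is off the hyperplane, so this is the triple
  coming from the forbidden vectors 3, 11 and 12.\<close>

definition kernel_codes :: "bool list list \<Rightarrow> bool list list" where
  "kernel_codes ps = filter (\<lambda>k. \<not> hd k) (map (comb_codes 5 ps) forbidden_codes)"

text \<open>A certificate for one normal form: \<open>T\<close> contains the elements of the set off
  the hyperplane, and \<open>b\<close> bounds the number of those in it.\<close>

definition covers :: "bool list list \<Rightarrow> nat \<Rightarrow> bool list list list \<Rightarrow> bool" where
  "covers T b F \<longleftrightarrow> list_all (compatible T) F \<and> unhittable (map kernel_codes F) b"

definition to_code :: "nat \<Rightarrow> bool list" where
  "to_code n = map (\<lambda>i. odd (n div 2 ^ i)) [4, 3, 2, 1, 0]"

text \<open>
  The following families come from a greedy computer search. Each entry lists a basis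
  relative to which the forbidden vectors avoid the respective point set.
\<close>

definition triangle_bases :: "nat list list" where
  "triangle_bases = [
    [16,12,3,9,13], [16,1,15,11,3], [18,4,9,7,6], [18,10,5,9,8], [18,7,9,4,5], [16,1,7,13,9],
    [17,4,14,7,5], [18,8,5,11,10], [18,15,1,10,13], [16,2,8,6,3], [16,15,3,9,14], [18,5,14,6,7],
    [18,7,15,4,5], [16,5,12,7,4], [20,9,2,14,13], [17,6,12,5,7], [16,10,5,8,11], [18,5,10,12,7],
    [16,7,14,5,6], [16,14,5,9,15], [18,11,4,8,9], [20,15,1,9,11], [18,15,1,8,13], [16,9,5,11,8],
    [16,1,12,9,3], [18,9,7,10,11], [16,2,15,7,3], [18,13,1,9,15], [24,6,1,12,14],
    [20,11,1,12,15], [16,12,7,9,13], [17,9,5,10,8], [24,4,3,13,12], [18,6,8,5,4], [17,6,9,5,7],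
    [20,10,1,13,14], [17,4,11,7,5], [18,9,4,14,11], [16,10,4,12,11], [18,6,12,5,4],
    [17,4,15,7,5], [16,2,14,7,3], [20,13,2,8,9], [20,10,3,12,14], [17,5,9,6,4], [16,14,4,8,15],
    [17,5,14,6,4], [17,11,4,12,10], [17,3,13,7,2], [17,5,11,13,4], [16,1,13,5,3],
    [18,12,1,11,14], [16,1,10,7,3], [16,4,11,6,5], [20,15,2,8,11], [18,4,8,7,6], [16,12,3,8,13],
    [16,6,11,4,7], [16,2,14,11,3], [17,3,12,6,2], [16,11,7,9,10], [16,7,9,5,6], [18,4,13,7,6],
    [17,6,9,12,7], [18,9,4,10,11], [20,11,1,13,15], [16,6,8,4,7], [16,13,7,8,12], [17,3,13,6,2],
    [18,8,5,14,10], [17,8,7,11,9], [17,7,15,4,6], [16,1,12,5,3]]"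

definition simplex_bases :: "nat list list" where
  "simplex_bases = [
    [17,5,11,13,4], [17,5,9,6,4], [18,6,8,5,4], [17,14,2,11,15], [16,12,6,8,13], [20,8,3,13,12],
    [17,14,4,9,15], [16,10,5,8,11], [18,13,1,10,15], [17,13,2,10,12], [16,8,5,10,9],
    [17,15,2,8,14], [18,14,1,8,12], [17,3,11,6,2], [20,12,2,9,8], [17,10,4,9,11],
    [17,11,4,12,10], [17,5,15,6,4], [18,15,1,9,13], [25,9,7,4,1]]"

definition plane_bases :: "nat list list" where
  "plane_bases = [
    [20,15,1,9,11], [24,4,2,13,12], [24,5,2,14,13], [20,4,14,12,1], [24,7,1,12,15],
    [28,15,10,2,9], [20,11,1,13,15], [20,15,1,8,11], [24,10,5,4,2], [20,11,1,12,15],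
    [24,4,3,13,12], [20,14,1,9,10], [20,6,13,12,2], [24,5,2,12,13], [28,12,9,2,10],
    [20,10,1,12,14]]"

text \<open>In a basis \<open>[t, d, c, b, a]\<close> these are \<open>t\<close>,
  \<open>t + a\<close> and \<open>t + b\<close>. The list is only an upper bound, so it also serves
  for one or two points.\<close>

definition triangle_points :: "bool list list" where
  "triangle_points = [[True,False,False,False,False], [True,False,False,False,True],
     [True,False,False,True,False]]"

text \<open>The fourth point is \<open>t + c\<close>, affinely independent of the others.\<close>

definition simplex_points :: "bool list list" where
  "simplex_points = triangle_points @ [[True,False,True,False,False]]"

text \<open>The fourth point is \<open>t + a + b\<close>, which completes the triangle to an affine
  plane.\<close>

definition plane_points :: "bool list list" where
  "plane_points = triangle_points @ [[True,False,False,True,True]]"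

text \<open>The bound 9 is for the extreme case of a single element off the hyperplane.\<close>

lemma covers_triangle: "covers triangle_points 9 (map (map to_code) triangle_bases)"
  unfolding covers_def triangle_points_def triangle_bases_def compatible_def forbidden_codes_def kernel_codes_def
  by code_simp

text \<open>Four elements off the hyperplane leave at most six in it.\<close>

lemma covers_simplex: "covers simplex_points 6 (map (map to_code) simplex_bases)"
  unfolding covers_def simplex_points_def triangle_points_def simplex_bases_def
    compatible_def forbidden_codes_def kernel_codes_def
  by code_simp

lemma covers_plane: "covers plane_points 6 (map (map to_code) plane_bases)"
  unfolding covers_def plane_points_def triangle_points_def plane_bases_def
    compatible_def forbidden_codes_def kernel_codes_def
  by code_simp

section \<open>Choosing a basis whose forbidden vectors avoid a given set\<close>

context boolean_group
begin

text \<open>The elements of \<open>X\<close> in the hyperplane are too few to hit all triples, so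
  some position misses them there; compatibility settles the forbidden vectors off the
  hyperplane.\<close>

lemma covers_avoid:
  fixes bs :: "'v list"
  assumes bs: "indep bs" "length bs = 5"
    and F: "covers T b F"
    and X: "card {k \<in> codes 5. \<not> hd k \<and> comb bs k \<in> X} \<le> b"
      "\<And>k. k \<in> codes 5 \<Longrightarrow> hd k \<Longrightarrow> comb bs k \<in> X \<Longrightarrow> k \<in> set T"
  shows "\<exists>cs. length cs = 5 \<and> indep cs \<and> (\<forall>w\<in>set forbidden_codes. comb cs w \<notin> X)"
proof -
  define Y where "Y = {k \<in> codes 5. \<not> hd k \<and> comb bs k \<in> X}"
  have "finite Y" by (simp add: Y_def)
  then obtain ps where ps: "ps \<in> set F" and Y: "set (kernel_codes ps) \<inter> Y = {}"
    using F X(1) unhittable_sound[of "map kernel_codes F" b Y] by (auto simp: covers_def Y_def)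
  have "compatible T ps" using F ps by (simp add: covers_def list_all_iff)
  then have len: "length ps = 5" "\<forall>p\<in>set ps. length p = 5"
    and nz: "\<And>ks. length ks = 5 \<Longrightarrow> True \<in> set ks \<Longrightarrow> comb_codes 5 ps ks \<noteq> replicate 5 False"
    and T: "\<And>w. w \<in> set forbidden_codes \<Longrightarrow> hd (comb_codes 5 ps w) \<Longrightarrow> comb_codes 5 ps w \<notin> set T"
    by (auto simp: compatible_def list_all_iff set_n_lists)
  define cs where "cs = map (comb bs) ps"
  have cs: "comb cs ks = comb bs (comb_codes 5 ps ks)" for ks
    unfolding cs_def using comb_map_comb[of ps bs] len bs(2) by simp
  have lc: "length (comb_codes 5 ps ks) = 5" for ks
    using len by (simp add: length_comb_codes)
  have "indep cs"
    unfolding indep_def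
  proof (intro allI impI)
    fix ks assume ks: "length ks = length cs" "comb cs ks = 0"
    with bs lc have "True \<notin> set (comb_codes 5 ps ks)"
      unfolding indep_def cs by simp
    then have "comb_codes 5 ps ks = replicate 5 False"
      using lc by (intro replicate_eqI) auto
    then show "True \<notin> set ks" using nz ks(1) len by (auto simp: cs_def)
  qed
  moreover have "comb cs w \<notin> X" if "w \<in> set forbidden_codes" for w
  proof
    assume "comb cs w \<in> X"
    then have k: "comb bs (comb_codes 5 ps w) \<in> X" "comb_codes 5 ps w \<in> codes 5"
      using lc by (simp_all add: cs codes_def)
    show False
    proof (cases "hd (comb_codes 5 ps w)")
      case True
      then show False using X(2) k T that by blast
    next
      case False
      with k have "comb_codes 5 ps w \<in> Y" by (simp add: Y_def)
      moreover have "comb_codes 5 ps w \<in> set (kernel_codes ps)"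
        using False that by (simp add: kernel_codes_def)
      ultimately show False using Y by blast
    qed
  qed
  ultimately show ?thesis using len by (intro exI[of _ cs]) (simp add: cs_def)
qed

text \<open>
  Each vector outside the span of \<open>e3, e4, e5\<close> passes exactly two of the three nonzero tests that
  vanish on this span, so some test is passed by at most \<open>2 * 7 div 3\<close> elements of \<open>X\<close>.
\<close>

lemma exists_light_test:
  fixes e1 e2 e3 e4 e5 :: 'v
  assumes card: "card (UNIV :: 'v set) = 32"
    and es: "indep [e1, e2, e3, e4, e5]" "{e1, e2, e3, e4, e5} \<subseteq> X"
    and X: "card X \<le> 10"
  obtains f t where "additive_test f" "t \<in> X" "f t" "card {v \<in> X. f v} \<le> 4"
proof -
  let ?es = "[e1, e2, e3, e4, e5]"
  have "length ?es = 5" by simp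
  moreover have "card (UNIV :: 'v set) = 2 ^ 5" using card by simp
  ultimately have bij: "bij_betw (comb ?es) (codes 5) UNIV"
    using bij_betw_comb[OF es(1)] by metis
  define g where "g = inv_into (codes 5) (comb ?es)"
  have surj: "v \<in> comb ?es ` codes 5" for v using bij by (simp only: bij_betw_def) simp
  have g: "length (g v) = 5" "comb ?es (g v) = v" for v
    using inv_into_into[OF surj[of v]] f_inv_into_f[OF surj[of v]]
    unfolding g_def codes_def mem_Collect_eq by blast+
  have g_eq: "g (comb ?es k) = k" if "length k = 5" for k
    unfolding g_def by (rule inv_into_f_f) (use bij that in \<open>simp_all only: bij_betw_def codes_def mem_Collect_eq\<close>)
  have g_add: "g (v + w) = xor_list (g v) (g w)" for v w
    using g_eq[of "xor_list (g v) (g w)"] comb_xor_list[of "g v" ?es "g w"] by (simp add: g)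
  have nth: "g (v + w) ! i \<longleftrightarrow> g v ! i \<noteq> g w ! i" if "i < 5" for v w i
    using that by (simp add: g_add xor_list_def g(1))
  have ge: "g e1 = [True,False,False,False,False]" "g e2 = [False,True,False,False,False]"
    "g e3 = [False,False,True,False,False]" "g e4 = [False,False,False,True,False]"
    "g e5 = [False,False,False,False,True]"
    using g_eq[of "[True,False,False,False,False]"] g_eq[of "[False,True,False,False,False]"]
      g_eq[of "[False,False,True,False,False]"] g_eq[of "[False,False,False,True,False]"]
      g_eq[of "[False,False,False,False,True]"] by simp_all
  define f1 where "f1 v = g v ! 0" for v
  define f2 where "f2 v = g v ! 1" for v
  define f3 where "f3 v = (f1 v \<noteq> f2 v)" for v
  have add: "additive_test f1" "additive_test f2" "additive_test f3"
    unfolding additive_test_def f3_def f1_def f2_def by (auto simp: nth)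
  have "finite X" by simp
  define A where "A = {v \<in> X. f1 v}"
  define B where "B = {v \<in> X. f2 v}"
  have "A \<union> B \<subseteq> X - {e3, e4, e5}"
    by (auto simp: A_def B_def f1_def f2_def ge)
  then have "card (A \<union> B) \<le> card (X - {e3, e4, e5})" by (intro card_mono) auto
  also have "\<dots> = card X - card {e3, e4, e5}"
    using es(2) by (intro card_Diff_subset) auto
  finally have "card (A \<union> B) \<le> card X - card {e3, e4, e5}" .
  moreover have "g e3 \<noteq> g e4 \<and> g e3 \<noteq> g e5 \<and> g e4 \<noteq> g e5" by (simp add: ge)
  then have "e3 \<noteq> e4" "e3 \<noteq> e5" "e4 \<noteq> e5" by metis+
  then have "card {e3, e4, e5} = 3" by simp
  ultimately have AB: "card (A \<union> B) \<le> 7" using X by simp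
  have "{v \<in> X. f3 v} = (A \<union> B) - (A \<inter> B)" by (auto simp: A_def B_def f3_def)
  then have "card {v \<in> X. f3 v} = card (A \<union> B) - card (A \<inter> B)"
    by (simp only:) (rule card_Diff_subset, auto)
  moreover have "card A + card B = card (A \<union> B) + card (A \<inter> B)"
    by (rule card_Un_Int) auto
  moreover have "card (A \<inter> B) \<le> card (A \<union> B)" by (intro card_mono) auto
  ultimately have "card {v \<in> X. f1 v} \<le> 4 \<or> card {v \<in> X. f2 v} \<le> 4 \<or> card {v \<in> X. f3 v} \<le> 4"
    using AB unfolding A_def B_def by linarith
  moreover have "f1 e1" "f2 e2" "f3 e1" by (simp_all add: f3_def f1_def f2_def ge)
  ultimately show thesis using that add es(2) by blast
qed

lemma indep_single: "indep [a]" if "a \<noteq> 0" for a :: 'v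
  using that by (simp add: indep_Cons codes_def)

lemma indep_pair:
  assumes "a \<noteq> 0" "b \<noteq> 0" "a \<noteq> (b :: 'v)"
  shows "indep [b, a]"
proof -
  have "comb [a] ks \<noteq> b" if ks: "length ks = 1" for ks
  proof -
    obtain k where "ks = [k]" using ks by (auto simp: length_Suc_conv)
    then show ?thesis using assms by (cases k) auto
  qed
  then show ?thesis using indep_single[OF assms(1)] by (auto simp: indep_Cons[of b] codes_def)
qed

text \<open>Over F_2 distinct nonzero vectors are independent, so up to two vectors only have to be
  padded to a pair inside the kernel.\<close>

lemma exists_indep_pair:
  assumes card: "card (UNIV :: 'v set) = 32"
    and f: "additive_test f" "f t"
    and D: "card D \<le> 2" "\<forall>d\<in>D. \<not> f d \<and> d \<noteq> 0"
  obtains a b :: 'v where "indep [b, a]" "\<not> f a" "\<not> f b" "D \<subseteq> {a, b}"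
proof -
  note result = that
  have extend: thesis if a: "a \<noteq> 0" "\<not> f a" "D \<subseteq> {a}" for a
  proof -
    obtain b where "\<not> f b" "indep [b, a]"
      using extend_indep_in_kernel[OF f indep_single[OF a(1)]] card by auto
    then show thesis using result a by blast
  qed
  have "finite D" by simp
  consider "card D = 0" | "card D = 1" | "card D = 2" using D(1) by linarith
  then show thesis
  proof cases
    case 1
    obtain a where "\<not> f a" "indep [a]"
      using extend_indep_in_kernel[OF f indep_Nil] card by auto
    moreover from this have "a \<noteq> 0" by (auto simp: indep_Cons codes_def)
    ultimately show thesis using extend 1 by simp
  next
    case 2
    then obtain a where "D = {a}" by (auto simp: card_1_singleton_iff)
    then show thesis using extend D(2) by auto
  next
    case 3
    then obtain a b where "D = {a, b}" "a \<noteq> b" by (auto simp: card_2_iff)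
    then show thesis using that[of b a] indep_pair[of a b] D(2) by auto
  qed
qed

theorem exists_basis_avoiding_forbidden_codes:
  fixes e1 e2 e3 e4 e5 :: 'v
  assumes card: "card (UNIV :: 'v set) = 32"
    and es: "indep [e1, e2, e3, e4, e5]" "{e1, e2, e3, e4, e5} \<subseteq> X"
    and X: "card X \<le> 10"
  shows "\<exists>cs :: 'v list. length cs = 5 \<and> indep cs \<and> (\<forall>w\<in>set forbidden_codes. comb cs w \<notin> X)"
proof -
  obtain f t where f: "additive_test f" "f t" and t: "t \<in> X" and light: "card {v \<in> X. f v} \<le> 4"
    using exists_light_test[OF card es X] by blast
  \<comment> \<open>With \<open>t\<close> as origin, the other elements of \<open>X\<close> off the
    hyperplane become nonzero vectors in it.\<close>
  define D where "D = (\<lambda>v. v + t) ` ({v \<in> X. f v} - {t})"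
  have "card D = card ({v \<in> X. f v} - {t})"
    unfolding D_def by (rule card_image) (auto simp: inj_on_def)
  moreover have "Suc (card ({v \<in> X. f v} - {t})) = card {v \<in> X. f v}"
    by (rule card_Suc_Diff1) (use f t in auto)
  ultimately have card_f: "card {v \<in> X. f v} = Suc (card D)" by simp
  have D: "\<forall>d\<in>D. \<not> f d \<and> d \<noteq> 0"
    using f by (auto simp: D_def additive_test_def add_eq_0_iff)
  have shift: "v = t \<or> v + t \<in> D" if "v \<in> X" "f v" for v
    using that by (auto simp: D_def)
  have card_ker: "card {v \<in> X. \<not> f v} + card {v \<in> X. f v} = card X"
    by (subst card_Un_disjoint[symmetric]) (auto intro!: arg_cong[where f = card])
  \<comment> \<open>The common end of all cases. In the basis \<open>[t, d, c, b, a]\<close> the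
    head of a code is the value of \<open>f\<close>, so \<open>T\<close> and \<open>m\<close>
    control the two parts of \<open>X\<close> as \<open>covers_avoid\<close> asks.\<close>
  have finish: ?thesis
    if abcd: "indep [d, c, b, a]" "\<not> f a" "\<not> f b" "\<not> f c" "\<not> f d"
      and covers: "covers T m F" and m: "10 - Suc (card D) \<le> m"
      and T: "\<And>v. v \<in> insert 0 D \<Longrightarrow> \<exists>k\<in>set T. length k = 5 \<and> comb [t, d, c, b, a] k = t + v"
    for a b c d T m F
  proof (rule covers_avoid[OF _ _ covers])
    let ?bs = "[t, d, c, b, a]"
    have span: "\<not> f (comb [d, c, b, a] k)" for k
      using additive_test_comb[OF f(1), of "[d, c, b, a]" k] abcd by simp
    then have "t \<notin> comb [d, c, b, a] ` codes (length [d, c, b, a])" using f(2) by auto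
    then show indep: "indep ?bs" using abcd(1) indep_Cons by blast
    have "length ?bs = 5" by simp
    with indep have inj: "inj_on (comb ?bs) (codes 5)" using inj_on_comb by metis
    have f_comb: "f (comb ?bs k) \<longleftrightarrow> hd k" if "k \<in> codes 5" for k
      using that f span by (cases k) (auto simp: codes_def additive_test_def)
    have "card {k \<in> codes 5. \<not> hd k \<and> comb ?bs k \<in> X} =
        card (comb ?bs ` {k \<in> codes 5. \<not> hd k \<and> comb ?bs k \<in> X})"
      by (rule card_image[symmetric]) (rule inj_on_subset[OF inj], auto)
    also have "\<dots> \<le> card {v \<in> X. \<not> f v}"
      using f_comb by (intro card_mono) auto
    also have "\<dots> \<le> m" using card_ker card_f X m by linarith
    finally show "card {k \<in> codes 5. \<not> hd k \<and> comb ?bs k \<in> X} \<le> m" .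
    show "k \<in> set T" if k: "k \<in> codes 5" "hd k" "comb ?bs k \<in> X" for k
    proof -
      have "f (comb ?bs k)" using f_comb k by blast
      then have "comb ?bs k = t \<or> comb ?bs k + t \<in> D" using shift k(3) by blast
      then have "comb ?bs k + t \<in> insert 0 D" by auto
      then obtain k' where "k' \<in> set T" "length k' = 5" "comb ?bs k' = t + (comb ?bs k + t)"
        using T by blast
      then have "comb ?bs k' = comb ?bs k" "k' \<in> codes 5" by (simp_all add: ac_simps codes_def)
      then show ?thesis using inj k(1) \<open>k' \<in> set T\<close> by (auto dest: inj_onD)
    qed
  qed simp
  have "card D \<le> 3" using card_f light by simp
  then consider "card D \<le> 2" | "card D = 3" by linarith
  then show ?thesis
  proof cases
    case 1
    obtain a b where ab: "indep [b, a]" "\<not> f a" "\<not> f b" "D \<subseteq> {a, b}"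
      using exists_indep_pair[OF card f 1 D] by blast
    obtain c where c: "\<not> f c" "indep [c, b, a]"
      using extend_indep_in_kernel[OF f ab(1)] card by auto
    obtain d where d: "\<not> f d" "indep [d, c, b, a]"
      using extend_indep_in_kernel[OF f c(2)] card by auto
    show ?thesis
      using ab(4) by (intro finish[OF d(2) ab(2,3) c(1) d(1) covers_triangle])
        (auto simp: triangle_points_def)
  next
    case 2
    then obtain a b c where D_eq: "D = {a, b, c}" and neq: "a \<noteq> b" "a \<noteq> c" "b \<noteq> c"
      by (auto simp: card_3_iff)
    have fabc: "\<not> f a" "\<not> f b" "\<not> f c" "c \<noteq> 0" using D by (auto simp: D_eq)
    have ab: "indep [b, a]" using D neq(1) by (intro indep_pair) (auto simp: D_eq)
    show ?thesis
    \<comment> \<open>Three distinct nonzero vectors over F_2 are dependent exactly when they sum to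
      zero; this separates the affine plane from the affinely independent case.\<close>
    proof (cases "c = a + b")
      case True
      obtain c' where c': "\<not> f c'" "indep [c', b, a]"
        using extend_indep_in_kernel[OF f ab] card by auto
      obtain d where d: "\<not> f d" "indep [d, c', b, a]"
        using extend_indep_in_kernel[OF f c'(2)] card by auto
      show ?thesis
        using 2 True D_eq
        by (intro finish[OF d(2) fabc(1,2) c'(1) d(1) covers_plane])
          (auto simp: plane_points_def triangle_points_def ac_simps)
    next
      case False
      have "comb [b, a] ks \<noteq> c" if ks: "length ks = 2" for ks
      proof -
        obtain k l where "ks = [k, l]" using ks by (auto simp: numeral_2_eq_2 length_Suc_conv)
        then show ?thesis using False neq fabc(4) by (cases k; cases l) (auto simp: ac_simps)
      qed
      then have c: "indep [c, b, a]"
        using ab by (auto simp: indep_Cons[of c] codes_def numeral_2_eq_2)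
      obtain d where d: "\<not> f d" "indep [d, c, b, a]"
        using extend_indep_in_kernel[OF f c] card by auto
      show ?thesis
        using 2 D_eq
        by (intro finish[OF d(2) fabc(1-3) d(1) covers_simplex])
          (auto simp: simplex_points_def triangle_points_def)
    qed
  qed
qed

end

section \<open>Determinants of 0/1 matrices\<close>

text \<open>Laplace expansion along the top row, with \<open>cs\<close> the columns still in use. It
  mediates between \<open>det\<close> and the explicit formulas that are evaluated.\<close>

fun minor :: "nat list \<Rightarrow> bool list list \<Rightarrow> int" where
  "minor cs [] = 1"
| "minor cs (z # zs) =
     (\<Sum>i<length cs. (-1) ^ i * of_bool (z ! (cs ! i)) * minor (take i cs @ drop (Suc i) cs) zs)"

lemma minor_eq_det:
  assumes "length cs = length zs"
  shows "minor cs zs =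
    det (mat (length zs) (length zs) (\<lambda>(r, c). of_bool (zs ! r ! (cs ! c))))"
  using assms
proof (induction zs arbitrary: cs)
  case Nil
  then show ?case by simp
next
  case (Cons z zs)
  let ?n = "length zs"
  let ?A = "mat (Suc ?n) (Suc ?n) (\<lambda>(r, c). of_bool ((z # zs) ! r ! (cs ! c)) :: int)"
  have del: "mat_delete ?A 0 i =
      mat ?n ?n (\<lambda>(r, c). of_bool (zs ! r ! ((take i cs @ drop (Suc i) cs) ! c)))"
    if "i < Suc ?n" for i
    using that Cons.prems
    by (intro eq_matI) (auto simp: mat_delete_def nth_append)
  have "det ?A = (\<Sum>i<Suc ?n. ?A $$ (0, i) * cofactor ?A 0 i)"
    by (rule laplace_expansion_row) auto
  also have "\<dots> = (\<Sum>i<Suc ?n. (-1) ^ i * of_bool (z ! (cs ! i)) *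
      minor (take i cs @ drop (Suc i) cs) zs)"
  proof (rule sum.cong)
    fix i assume "i \<in> {..<Suc ?n}"
    moreover from this have "minor (take i cs @ drop (Suc i) cs) zs = det (mat_delete ?A 0 i)"
      using Cons.prems by (subst Cons.IH) (auto simp: del)
    ultimately show "?A $$ (0, i) * cofactor ?A 0 i = (-1) ^ i * of_bool (z ! (cs ! i)) *
      minor (take i cs @ drop (Suc i) cs) zs"
      by (simp add: cofactor_def)
  qed simp
  finally show ?case using Cons.prems by simp
qed

declare minor.simps [simp del]

text \<open>The evaluation meets each set of five rows in one order only; any other order changes at
  most the sign.\<close>

lemma abs_det_permute:
  fixes f :: "'a \<Rightarrow> nat \<Rightarrow> int"
  assumes "mset xs = mset ys"
  defines "n \<equiv> length ys"
  shows "\<bar>det (mat n n (\<lambda>(r, c). f (xs ! r) c))\<bar> = \<bar>det (mat n n (\<lambda>(r, c). f (ys ! r) c))\<bar>"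
proof -
  obtain p where p: "p permutes {..<length ys}" "permute_list p ys = xs"
    using mset_eq_permutation[OF assms(1)] by blast
  let ?A = "mat n n (\<lambda>(r, c). f (ys ! r) c)"
  have "mat n n (\<lambda>(r, c). f (xs ! r) c) = mat n n (\<lambda>(i, j). ?A $$ (p i, j))"
    using p permutes_in_image[OF p(1)] unfolding n_def
    by (intro eq_matI) (auto simp flip: p(2) simp: permute_list_nth)
  moreover have "det (mat n n (\<lambda>(i, j). ?A $$ (p i, j))) = signof p * det ?A"
    using p(1) by (intro det_permute_rows) (auto simp: n_def atLeast0LessThan)
  ultimately show ?thesis by (simp add: abs_mult sign_def)
qed

text \<open>
  A \<open>j\<close>-tuple of rows is recorded by its \<open>j \<times> j\<close> minors, listed lexicographically by columns.
\<close>

type_synonym int5 = "int \<times> int \<times> int \<times> int \<times> int"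

text \<open>Multiplication by a 0/1 entry; with it the expansions need no integer products.\<close>

definition sel :: "bool \<Rightarrow> int \<Rightarrow> int" where
  "sel b x = (if b then x else 0)"

text \<open>Each new row is put on top and expanded along, so rows end up in reverse order. Five
  columns have ten pairs, ten triples and five quadruples, whence the result types of this and the
  next two functions.\<close>

fun minors2 :: "bool list \<Rightarrow> bool list \<Rightarrow> int5 \<times> int5" where
  "minors2 [b0,b1,b2,b3,b4] [a0,a1,a2,a3,a4] =
     (let m = (\<lambda>a b c d. sel (a \<and> d) 1 - sel (b \<and> c) 1) in
      ((m b0 b1 a0 a1, m b0 b2 a0 a2, m b0 b3 a0 a3, m b0 b4 a0 a4, m b1 b2 a1 a2),
       (m b1 b3 a1 a3, m b1 b4 a1 a4, m b2 b3 a2 a3, m b2 b4 a2 a4, m b3 b4 a3 a4)))"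

fun minors3 :: "bool list \<Rightarrow> int5 \<times> int5 \<Rightarrow> int5 \<times> int5" where
  "minors3 [c0,c1,c2,c3,c4] ((m01,m02,m03,m04,m12),(m13,m14,m23,m24,m34)) =
     (let m = (\<lambda>a b c x y z. sel a z - sel b y + sel c x) in
      ((m c0 c1 c2 m01 m02 m12, m c0 c1 c3 m01 m03 m13, m c0 c1 c4 m01 m04 m14,
        m c0 c2 c3 m02 m03 m23, m c0 c2 c4 m02 m04 m24),
       (m c0 c3 c4 m03 m04 m34, m c1 c2 c3 m12 m13 m23, m c1 c2 c4 m12 m14 m24,
        m c1 c3 c4 m13 m14 m34, m c2 c3 c4 m23 m24 m34)))"

fun minors4 :: "bool list \<Rightarrow> int5 \<times> int5 \<Rightarrow> int5" where
  "minors4 [d0,d1,d2,d3,d4] ((m012,m013,m014,m023,m024),(m034,m123,m124,m134,m234)) =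
     (let m = (\<lambda>a b c d x y z w. sel a w - sel b z + sel c y - sel d x) in
      (m d0 d1 d2 d3 m012 m013 m023 m123, m d0 d1 d2 d4 m012 m014 m024 m124,
       m d0 d1 d3 d4 m013 m014 m034 m134, m d0 d2 d3 d4 m023 m024 m034 m234,
       m d1 d2 d3 d4 m123 m124 m134 m234))"

fun minors5 :: "bool list \<Rightarrow> int5 \<Rightarrow> int" where
  "minors5 [e0,e1,e2,e3,e4] (m0123,m0124,m0134,m0234,m1234) =
     sel e0 m1234 - sel e1 m0234 + sel e2 m0134 - sel e3 m0124 + sel e4 m0123"

lemma length5E:
  assumes "length (z :: 'a list) = 5"
  obtains a b c d e where "z = [a, b, c, d, e]"
  using assms by (auto simp: eval_nat_numeral length_Suc_conv)

text \<open>One row is treated at a time, with the minors of the previous rows folded into names, so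
  that each stage is a single Laplace expansion.\<close>

lemma minors5_eq_minor:
  assumes "\<forall>z\<in>{z1, z2, z3, z4, z5}. length z = 5"
  shows "minors5 z5 (minors4 z4 (minors3 z3 (minors2 z2 z1))) = minor [0,1,2,3,4] [z5,z4,z3,z2,z1]"
proof -
  have len: "length z1 = 5" "length z2 = 5" "length z3 = 5" "length z4 = 5" "length z5 = 5"
    using assms by auto
  obtain a0 a1 a2 a3 a4 where z1: "z1 = [a0,a1,a2,a3,a4]" using len(1) by (rule length5E)
  obtain b0 b1 b2 b3 b4 where z2: "z2 = [b0,b1,b2,b3,b4]" using len(2) by (rule length5E)
  obtain c0 c1 c2 c3 c4 where z3: "z3 = [c0,c1,c2,c3,c4]" using len(3) by (rule length5E)
  obtain d0 d1 d2 d3 d4 where z4: "z4 = [d0,d1,d2,d3,d4]" using len(4) by (rule length5E)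
  obtain e0 e1 e2 e3 e4 where z5: "z5 = [e0,e1,e2,e3,e4]" using len(5) by (rule length5E)
  define m where "m i j = minor [i, j] [z2, z1]" for i j
  define m3 where "m3 i j k = minor [i, j, k] [z3, z2, z1]" for i j k
  define m4 where "m4 i j k l = minor [i, j, k, l] [z4, z3, z2, z1]" for i j k l
  have mb: "sel b x = of_bool b * x" for b x by (simp add: sel_def)
  have s2: "minors2 z2 z1 = ((m 0 1, m 0 2, m 0 3, m 0 4, m 1 2), (m 1 3, m 1 4, m 2 3, m 2 4, m 3 4))"
    unfolding m_def z1 z2 by (simp add: sel_def minor.simps numeral_2_eq_2)
  have s3: "minors3 z3 (minors2 z2 z1) = ((m3 0 1 2, m3 0 1 3, m3 0 1 4, m3 0 2 3, m3 0 2 4),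
     (m3 0 3 4, m3 1 2 3, m3 1 2 4, m3 1 3 4, m3 2 3 4))"
    unfolding s2 m3_def minor.simps(2)[of _ z3] unfolding z3
    by (simp add: mb eval_nat_numeral lessThan_Suc flip: m_def)
  have s4: "minors4 z4 (minors3 z3 (minors2 z2 z1)) =
     (m4 0 1 2 3, m4 0 1 2 4, m4 0 1 3 4, m4 0 2 3 4, m4 1 2 3 4)"
    unfolding s3 m4_def minor.simps(2)[of _ z4] unfolding z4
    by (simp add: mb eval_nat_numeral lessThan_Suc flip: m3_def)
  show ?thesis
    unfolding s4 minor.simps(2)[of _ z5] unfolding z5
    by (simp add: mb eval_nat_numeral lessThan_Suc flip: m4_def)
qed

text \<open>Pairs each element with what follows it; nesting this runs through all sublists of a
  given length in list order.\<close>

fun all_tails :: "('a \<Rightarrow> 'a list \<Rightarrow> bool) \<Rightarrow> 'a list \<Rightarrow> bool" where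
  "all_tails P [] \<longleftrightarrow> True"
| "all_tails P (x # xs) \<longleftrightarrow> P x xs \<and> all_tails P xs"

text \<open>The remaining selected elements are still obtained by the same filter from the tail, so
  the lemma can be applied once per row.\<close>

lemma all_tails_filter:
  assumes "all_tails P zs" and "filter Q zs = x # xs"
  obtains ys where "P x ys" and "filter Q ys = xs"
  using assms by (induction zs) (auto split: if_splits)

text \<open>Even values pass because five vectors that are dependent mod 2 never colour a
  facet.\<close>

definition good_det :: "int \<Rightarrow> bool" where
  "good_det d \<longleftrightarrow> (if d = 0 then True else if d = 1 then True else if d = -1 then True else even d)"

text \<open>
  The recursive equations below, rather than those of \<open>all_tails\<close>, keep the evaluation first-order.
\<close>

fun good_minors4 :: "int5 \<Rightarrow> bool list list \<Rightarrow> bool" where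
  "good_minors4 m [] \<longleftrightarrow> True"
| "good_minors4 m (z # zs) \<longleftrightarrow> good_det (minors5 z m) \<and> good_minors4 m zs"

fun good_minors3 :: "int5 \<times> int5 \<Rightarrow> bool list list \<Rightarrow> bool" where
  "good_minors3 m [] \<longleftrightarrow> True"
| "good_minors3 m (z # zs) \<longleftrightarrow> good_minors4 (minors4 z m) zs \<and> good_minors3 m zs"

fun good_minors2 :: "int5 \<times> int5 \<Rightarrow> bool list list \<Rightarrow> bool" where
  "good_minors2 m [] \<longleftrightarrow> True"
| "good_minors2 m (z # zs) \<longleftrightarrow> good_minors3 (minors3 z m) zs \<and> good_minors2 m zs"

fun good_minors1 :: "bool list \<Rightarrow> bool list list \<Rightarrow> bool" where
  "good_minors1 z1 [] \<longleftrightarrow> True"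
| "good_minors1 z1 (z # zs) \<longleftrightarrow> good_minors2 (minors2 z z1) zs \<and> good_minors1 z1 zs"

fun unimodular_list :: "bool list list \<Rightarrow> bool" where
  "unimodular_list [] \<longleftrightarrow> True"
| "unimodular_list (z # zs) \<longleftrightarrow> good_minors1 z zs \<and> unimodular_list zs"

lemma good_minors4_iff: "good_minors4 m zs \<longleftrightarrow> (\<forall>z\<in>set zs. good_det (minors5 z m))"
  by (induction zs) auto

lemma good_minors3_iff: "good_minors3 m zs \<longleftrightarrow> all_tails (\<lambda>z. good_minors4 (minors4 z m)) zs"
  by (induction zs) auto

lemma good_minors2_iff: "good_minors2 m zs \<longleftrightarrow> all_tails (\<lambda>z. good_minors3 (minors3 z m)) zs"
  by (induction zs) auto

lemma good_minors1_iff: "good_minors1 z1 zs \<longleftrightarrow> all_tails (\<lambda>z. good_minors2 (minors2 z z1)) zs"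
  by (induction zs) auto

lemma unimodular_list_iff: "unimodular_list zs \<longleftrightarrow> all_tails good_minors1 zs"
  by (induction zs) auto

text \<open>Sorting \<open>zs\<close> into the order of \<open>Z\<close> gives a tuple that the
  nested check has visited. The reordering costs a sign, to which \<open>good_det\<close> is
  insensitive.\<close>

lemma good_det_of_unimodular_list:
  assumes Z: "unimodular_list Z" "distinct Z" "\<forall>z\<in>set Z. length z = 5"
    and zs: "distinct zs" "length zs = 5" "set zs \<subseteq> set Z"
  shows "good_det (det (mat 5 5 (\<lambda>(r, c). of_bool (zs ! r ! c))))"
proof -
  define xs where "xs = filter (\<lambda>z. z \<in> set zs) Z"
  have "mset xs = mset zs"
    using Z(2) zs by (subst set_eq_iff_mset_eq_distinct[symmetric]) (auto simp: xs_def)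
  then have len: "length xs = 5" by (metis size_mset zs(2))
  then obtain z1 z2 z3 z4 z5 where xs: "xs = [z1, z2, z3, z4, z5]" by (elim length5E)
  let ?Q = "\<lambda>z. z \<in> set zs"
  have "filter ?Q Z = [z1, z2, z3, z4, z5]" using xs by (simp only: xs_def)
  then obtain t1 where 1: "good_minors1 z1 t1" "filter ?Q t1 = [z2, z3, z4, z5]"
    by (rule all_tails_filter[OF Z(1)[unfolded unimodular_list_iff]])
  obtain t2 where 2: "good_minors2 (minors2 z2 z1) t2" "filter ?Q t2 = [z3, z4, z5]"
    by (rule all_tails_filter[OF 1[unfolded good_minors1_iff]])
  obtain t3 where 3: "good_minors3 (minors3 z3 (minors2 z2 z1)) t3" "filter ?Q t3 = [z4, z5]"
    by (rule all_tails_filter[OF 2[unfolded good_minors2_iff]])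
  obtain t4 where 4: "good_minors4 (minors4 z4 (minors3 z3 (minors2 z2 z1))) t4" "filter ?Q t4 = [z5]"
    by (rule all_tails_filter[OF 3[unfolded good_minors3_iff]])
  have "z5 \<in> set t4" using 4(2) by (metis filter_is_subset list.set_intros(1) subsetD)
  then have "good_det (minors5 z5 (minors4 z4 (minors3 z3 (minors2 z2 z1))))"
    using 4(1) by (simp add: good_minors4_iff)
  moreover have "\<forall>z\<in>{z1, z2, z3, z4, z5}. length z = 5"
  proof
    fix z assume "z \<in> {z1, z2, z3, z4, z5}"
    then have "z \<in> set xs" by (simp add: xs)
    then show "length z = 5" using Z(3) by (simp add: xs_def)
  qed
  moreover have "rev xs = [z5, z4, z3, z2, z1]" by (simp add: xs)
  ultimately have "good_det (minor [0,1,2,3,4] (rev xs))"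
    using minors5_eq_minor by metis
  also have "minor [0,1,2,3,4] (rev xs) =
      det (mat 5 5 (\<lambda>(r, c). of_bool (rev xs ! r ! ([0,1,2,3,4] ! c))))"
    by (subst minor_eq_det) (simp_all add: len)
  also have "mat 5 5 (\<lambda>(r, c). of_bool (rev xs ! r ! ([0,1,2,3,4] ! c))) =
      (mat 5 5 (\<lambda>(r, c). of_bool (rev xs ! r ! c)) :: int mat)"
  proof (rule cong_mat)
    fix r c :: nat assume "c < 5"
    then have "c \<in> {0,1,2,3,4}" by auto
    then have "[0,1,2,3,4] ! c = c" by (auto simp: eval_nat_numeral)
    then show "(\<lambda>(r, c). of_bool (rev xs ! r ! ([0,1,2,3,4] ! c))) (r, c) =
       (\<lambda>(r, c). of_bool (rev xs ! r ! c) :: int) (r, c)" by simp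
  qed auto
  finally have "good_det (det (mat 5 5 (\<lambda>(r, c). of_bool (rev xs ! r ! c))))" .
  moreover have "\<bar>det (mat 5 5 (\<lambda>(r, c). of_bool (rev xs ! r ! c) :: int))\<bar> =
      \<bar>det (mat 5 5 (\<lambda>(r, c). of_bool (zs ! r ! c)))\<bar>"
    using abs_det_permute[of "rev xs" zs "\<lambda>z c. of_bool (z ! c)"] \<open>mset xs = mset zs\<close> zs(2)
    by simp
  ultimately show ?thesis
    by (auto simp: good_det_def abs_eq_iff split: if_splits)
qed

definition allowed_codes :: "bool list list" where
  "allowed_codes = filter (\<lambda>k. True \<in> set k \<and> k \<notin> set forbidden_codes) (List.n_lists 5 [False,True])"

lemma set_allowed_codes: "set allowed_codes = {k. length k = 5 \<and> True \<in> set k \<and> k \<notin> set forbidden_codes}"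
  by (auto simp: allowed_codes_def set_n_lists)

lemma distinct_allowed_codes: "distinct allowed_codes"
  by (simp add: allowed_codes_def distinct_n_lists)

text \<open>Evaluates all 11628 five-element subsets of the nineteen codes, sharing the minors of
  common initial rows.\<close>

lemma unimodular_allowed_codes: "unimodular_list allowed_codes"
  unfolding allowed_codes_def forbidden_codes_def by code_simp

section \<open>Colorings\<close>

lemma UNIV_bit: "(UNIV :: bit set) = {0, 1}"
proof (intro equalityI subsetI)
  fix b :: bit
  show "b \<in> {0, 1}" by (cases b) auto
qed auto

instance bit :: finite
  by standard (simp add: UNIV_bit)

lemma card_UNIV_bit: "card (UNIV :: bit set) = 2"
  unfolding UNIV_bit by simp

text \<open>The type \<open>bit vec\<close> holds vectors of every dimension; a product type is
  finite and an additive group, as \<open>boolean_group\<close> demands.\<close>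

type_synonym bit5 = "bit \<times> bit \<times> bit \<times> bit \<times> bit"

lemma card_UNIV_bit5: "card (UNIV :: bit5 set) = 32"
  by (simp add: card_UNIV_bit card_cartesian_product flip: UNIV_Times_UNIV)

interpretation bit5: boolean_group "TYPE(bit5)"
proof
  fix v :: bit5
  have "b + b = 0" for b :: bit by (cases b) simp_all
  then show "v + v = 0" by (cases v) (simp add: zero_prod_def)
qed

definition bit5_of_vec :: "bit vec \<Rightarrow> bit5" where
  "bit5_of_vec u = (u $ 0, u $ 1, u $ 2, u $ 3, u $ 4)"

lemma bit5_of_vec_inject:
  assumes "u \<in> carrier_vec 5" "w \<in> carrier_vec 5" "bit5_of_vec u = bit5_of_vec w"
  shows "u = w"
proof (rule eq_vecI)
  fix i assume "i < dim_vec w"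
  then have "i \<in> {0,1,2,3,4}" using assms(2) by auto
  then show "u $ i = w $ i" using assms(3) by (auto simp: bit5_of_vec_def)
qed (use assms in auto)

text \<open>Polymorphic, so that the same code can be read over F_2 and over the integers.\<close>

definition vec_of_code :: "bool list \<Rightarrow> 'a::zero_neq_one vec" where
  "vec_of_code ks = vec 5 (\<lambda>i. of_bool (ks ! i))"

lemma vec_of_code_carrier [simp]: "vec_of_code ks \<in> carrier_vec 5"
  by (simp add: vec_of_code_def)

lemma vec_of_code_inject:
  assumes "length ks = 5" "length ls = 5" "(vec_of_code ks :: 'a::zero_neq_one vec) = vec_of_code ls"
  shows "ks = ls"
proof (rule nth_equalityI)
  fix i assume "i < length ks"
  then have "(vec_of_code ks :: 'a vec) $ i = vec_of_code ls $ i" "i < 5" using assms by simp_all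
  then show "ks ! i = ls ! i"
    by (auto simp: vec_of_code_def of_bool_def split: if_splits)
qed (simp add: assms)

lemma comb_bit5_of_vec:
  assumes "length us = 5" "length ks = 5"
  shows "comb (map bit5_of_vec us) ks = bit5_of_vec (mat_of_cols 5 us *\<^sub>v vec_of_code ks)"
proof -
  obtain u0 u1 u2 u3 u4 where us: "us = [u0,u1,u2,u3,u4]" using assms(1) by (rule length5E)
  obtain k0 k1 k2 k3 k4 where ks: "ks = [k0,k1,k2,k3,k4]" using assms(2) by (rule length5E)
  have sum5: "(\<Sum>j\<in>{0..<5}. F j) = F 0 + F 1 + F 2 + F 3 + F 4" for F :: "nat \<Rightarrow> bit"
    by (simp add: eval_nat_numeral)
  define f where "f i = of_bool k0 * u0 $ i + of_bool k1 * u1 $ i + of_bool k2 * u2 $ i +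
      of_bool k3 * u3 $ i + of_bool k4 * u4 $ i" for i
  have nth: "(mat_of_cols 5 us *\<^sub>v vec_of_code ks) $ i = f i" if "i < 5" for i
    using that
    by (simp add: f_def us ks scalar_prod_def vec_of_code_def mat_of_cols_def sum5 mult.commute
        del: add_bit_eq_xor mult_bit_eq_and)
  have step: "comb (bit5_of_vec u # vs) (k # ls) =
      (of_bool k * u $ 0, of_bool k * u $ 1, of_bool k * u $ 2, of_bool k * u $ 3, of_bool k * u $ 4)
      + comb vs ls" for u vs k ls
    by (cases k) (simp_all add: bit5_of_vec_def flip: zero_prod_def)
  have "comb [] [] = (0, 0, 0, 0, 0 :: bit)" by (simp add: zero_prod_def)
  then have "comb (map bit5_of_vec us) ks = (f 0, f 1, f 2, f 3, f 4)"
    by (simp add: us ks step f_def add.assoc del: comb.simps(1) add_bit_eq_xor mult_bit_eq_and)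
  also have "\<dots> = bit5_of_vec (mat_of_cols 5 us *\<^sub>v vec_of_code ks)"
    by (simp add: bit5_of_vec_def nth del: index_mult_mat_vec)
  finally show ?thesis .
qed

text \<open>A vanishing subset sum is a kernel vector of the matrix with columns \<open>us\<close>,
  and a nonzero kernel vector would be a linear dependence.\<close>

lemma indep_bit5_of_vec:
  assumes us: "length us = 5" "set us \<subseteq> carrier_vec 5" "distinct us"
    and li: "\<not> LinearCombinations.module.lin_dep class_ring (module_vec TYPE(bit) 5) (set us)"
  shows "indep (map bit5_of_vec us)"
  unfolding indep_def
proof (intro allI impI)
  fix ks assume ks: "length ks = length (map bit5_of_vec us)" "comb (map bit5_of_vec us) ks = 0"
  interpret vec_space "TYPE(bit)" 5 .
  let ?A = "mat_of_cols 5 us"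
  have A: "?A \<in> carrier_mat 5 5" using mat_of_cols_carrier(1)[of 5 us] us(1) by simp
  have cols: "cols ?A = us" using us by (simp add: cols_mat_of_cols)
  have "bit5_of_vec (0\<^sub>v 5) = 0" by (simp add: bit5_of_vec_def zero_prod_def)
  then have "bit5_of_vec (?A *\<^sub>v vec_of_code ks) = bit5_of_vec (0\<^sub>v 5)"
    using ks us(1) comb_bit5_of_vec[of us ks] by simp
  then have "?A *\<^sub>v vec_of_code ks = 0\<^sub>v 5"
    by (intro bit5_of_vec_inject) (use A in auto)
  then have "(vec_of_code ks :: bit vec) = 0\<^sub>v 5"
    using lin_depI[OF A, of "vec_of_code ks"] li us(3) by (auto simp: cols)
  moreover have "(0\<^sub>v 5 :: bit vec) = vec_of_code (replicate 5 False)"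
    by (intro eq_vecI) (simp_all add: vec_of_code_def)
  ultimately have "ks = replicate 5 False"
    using ks(1) us(1) by (intro vec_of_code_inject[where 'a = bit]) simp_all
  then show "True \<notin> set ks" by simp
qed

lemma of_bool_comb_codes:
  assumes "length ks = length ps" "\<forall>p\<in>set ps. length p = n" "j < n"
  shows "(of_bool (comb_codes n ps ks ! j) :: bit) = (\<Sum>r<length ps. of_bool (ks ! r) * of_bool (ps ! r ! j))"
  using assms
proof (induction ps arbitrary: ks)
  case (Cons p ps)
  then obtain k ks' where ks: "ks = k # ks'" by (metis length_Suc_conv list.size(4) Suc_eq_plus1)
  have "length (comb_codes n ps ks') = n" using Cons.prems by (intro length_comb_codes) simp
  then have "(of_bool (comb_codes n (p # ps) ks ! j) :: bit) =
      of_bool k * of_bool (p ! j) + of_bool (comb_codes n ps ks' ! j)"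
    using Cons.prems by (auto simp: ks xor_list_def)
  moreover have "(of_bool (comb_codes n ps ks' ! j) :: bit) =
      (\<Sum>r<length ps. of_bool (ks' ! r) * of_bool (ps ! r ! j))"
    using Cons.prems by (intro Cons.IH) (simp_all add: ks)
  ultimately show ?case
    by (simp only: ks length_Cons sum.lessThan_Suc_shift nth_Cons_0 nth_Cons_Suc)
qed simp

text \<open>If the determinant were even, its reduction mod 2 would be singular. The codes are rows,
  so a kernel vector of the transpose gives a nontrivial subset sum equal to zero.\<close>

lemma odd_det_of_codes:
  fixes zs :: "bool list list"
  assumes zs: "length zs = 5" "\<forall>z\<in>set zs. length z = 5"
    and inj: "\<And>ks. length ks = 5 \<Longrightarrow> comb_codes 5 zs ks = replicate 5 False \<Longrightarrow> True \<notin> set ks"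
  shows "odd (det (mat 5 5 (\<lambda>(r, c). of_bool (zs ! r ! c))) :: int)"
proof
  let ?D = "mat 5 5 (\<lambda>(r, c). of_bool (zs ! r ! c)) :: int mat"
  let ?E = "mat 5 5 (\<lambda>(r, c). of_bool (zs ! r ! c)) :: bit mat"
  assume "even (det ?D)"
  have "map_mat of_int ?D = ?E" by (intro eq_matI) auto
  then have "det ?E = of_int (det ?D)" by (metis of_int_hom.hom_det)
  also have "\<dots> = 0" using \<open>even (det ?D)\<close> by (auto elim!: evenE)
  finally have "det (transpose_mat ?E) = 0" by (subst det_transpose[of _ 5]) auto
  then obtain x where x: "x \<in> carrier_vec 5" "x \<noteq> 0\<^sub>v 5" "transpose_mat ?E *\<^sub>v x = 0\<^sub>v 5"
    using det_0_iff_vec_prod_zero_field[of "transpose_mat ?E" 5] by auto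
  define ks where "ks = map (\<lambda>i. x $ i = 1) [0..<5]"
  have ks: "length ks = 5" "of_bool (ks ! i) = x $ i" if "i < 5" for i
    using that by (auto simp: ks_def)
  have len: "length ks = 5" by (simp add: ks_def)
  have "comb_codes 5 zs ks = replicate 5 False"
  proof (rule nth_equalityI)
    show "length (comb_codes 5 zs ks) = length (replicate 5 False)"
      using zs(2) by (simp add: length_comb_codes)
    fix j assume "j < length (comb_codes 5 zs ks)"
    then have j: "j < 5" using zs(2) by (simp add: length_comb_codes)
    have "(of_bool (comb_codes 5 zs ks ! j) :: bit) = (\<Sum>r<5. of_bool (ks ! r) * of_bool (zs ! r ! j))"
      using of_bool_comb_codes[of ks zs 5 j] zs j len by simp
    also have "\<dots> = (transpose_mat ?E *\<^sub>v x) $ j"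
      using j x(1) by (auto simp: scalar_prod_def ks atLeast0LessThan conj_commute)
    also have "\<dots> = 0" using x(3) j by simp
    finally show "comb_codes 5 zs ks ! j = replicate 5 False ! j" using j by simp
  qed
  then have "True \<notin> set ks" using inj len by blast
  then have "x $ i = 0" if "i < 5" for i
    using that len ks[OF that] nth_mem[of i ks] by (cases "ks ! i") auto
  then have "x = 0\<^sub>v 5" using x(1) by (intro eq_vecI) auto
  then show False using x(2) by blast
qed

lemma integral_basis_of_unimodular:
  fixes us :: "int vec list"
  assumes us: "length us = 5" "set us \<subseteq> carrier_vec 5" and det: "\<bar>det (mat_of_cols 5 us)\<bar> = 1"
  shows "integral_basis 5 (set us)"
proof -
  interpret idom_vec 5 "TYPE(int)" .
  let ?A = "mat_of_cols 5 us"
  have A: "?A \<in> carrier_mat 5 5" using mat_of_cols_carrier(1)[of 5 us] us(1) by simp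
  have cols: "cols ?A = us" using us by (simp add: cols_mat_of_cols)
  have "lin_indpt (set us)"
    using lin_dep_cols_imp_det_0[OF A] det by (auto simp: cols)
  moreover have "span (set us) = carrier_vec 5"
  proof
    show "span (set us) \<subseteq> carrier_vec 5" using us(2) span_is_subset2 by simp
    show "carrier_vec 5 \<subseteq> span (set us)"
    proof
      fix x :: "int vec" assume x: "x \<in> carrier_vec 5"
      \<comment> \<open>As \<open>det ?A\<close> is 1 or -1, it is its own inverse, and
        \<open>det ?A\<close> times the adjugate inverts \<open>?A\<close> over the
        integers.\<close>
      define y where "y = det ?A \<cdot>\<^sub>v (adj_mat ?A *\<^sub>v x)"
      note adj = adj_mat[OF A]
      have y: "y \<in> carrier_vec 5" using adj(1) x by (simp add: y_def)
      have smult: "M *\<^sub>v (k \<cdot>\<^sub>v v) = k \<cdot>\<^sub>v (M *\<^sub>v v)" "(k \<cdot>\<^sub>m M) *\<^sub>v v = k \<cdot>\<^sub>v (M *\<^sub>v v)"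
        if "M \<in> carrier_mat 5 5" "v \<in> carrier_vec 5" for M :: "int mat" and k v
        using that by (auto intro!: eq_vecI simp: scalar_prod_def sum_distrib_left mult.assoc mult.left_commute)
      have "?A *\<^sub>v y = det ?A \<cdot>\<^sub>v ((?A * adj_mat ?A) *\<^sub>v x)"
        using A adj(1) x by (simp add: y_def smult assoc_mult_mat_vec[of _ 5 5 _ 5])
      also have "\<dots> = det ?A \<cdot>\<^sub>v (det ?A \<cdot>\<^sub>v x)"
        unfolding adj(2) using x by (simp add: smult)
      also have "\<dots> = x" using det x by (auto simp: smult_smult_assoc abs_if split: if_splits)
      finally have "x = ?A *\<^sub>v vec (length us) (\<lambda>i. y $ i)" using y us(1) by (auto intro!: arg_cong[where f = "\<lambda>v. ?A *\<^sub>v v"])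
      also have "\<dots> = lincomb_list (\<lambda>i. y $ i) us"
        using us(2) by (intro lincomb_list_as_mat_mult[symmetric]) auto
      finally have "x \<in> span_list us" by (auto simp: span_list_def)
      then show "x \<in> span (set us)" using span_list_as_span[OF us(2)] by simp
    qed
  qed
  ultimately show ?thesis using us(2) by (simp add: integral_basis_def)
qed

lemma exists_zero_one_coloring:
  assumes sc: "simplicial_complex K" and pure: "\<And>\<sigma>. \<sigma> \<in> facets K \<Longrightarrow> card \<sigma> = 5"
    and card: "card (\<Union>K) \<le> 10"
    and c: "mod2_toric_coloring 5 K c"
  shows "\<exists>\<kappa>. (\<forall>v\<in>\<Union>K. length (\<kappa> v) = 5 \<and> True \<in> set (\<kappa> v)) \<and>
    (\<forall>vs. distinct vs \<and> set vs \<in> facets K \<longrightarrow>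
       distinct (map \<kappa> vs) \<and> \<bar>det (mat_of_cols 5 (map (\<lambda>v. vec_of_code (\<kappa> v) :: int vec) vs))\<bar> = 1)"
proof -
  define u where "u v = bit5_of_vec (c v)" for v
  have facet_sub: "\<sigma> \<in> K" "\<sigma> \<subseteq> \<Union>K" if "\<sigma> \<in> facets K" for \<sigma>
    using that by (auto simp: facets_def)
  have indep: "indep (map u vs)" "length vs = 5" if vs: "distinct vs" "set vs \<in> facets K" for vs
  proof -
    show len: "length vs = 5" using pure[OF vs(2)] distinct_card[OF vs(1)] by simp
    have "inj_on c (set vs)"
      and li: "\<not> LinearCombinations.module.lin_dep class_ring (module_vec TYPE(bit) 5) (c ` set vs)"
      and car: "\<forall>v\<in>set vs. c v \<in> carrier_vec 5"
      using c facet_sub[OF vs(2)] by (auto simp: mod2_toric_coloring_def)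
    then have "indep (map bit5_of_vec (map c vs))"
      using vs(1) len by (intro indep_bit5_of_vec) (auto simp: distinct_map)
    then show "indep (map u vs)" by (simp add: u_def[abs_def] comp_def)
  qed
  obtain \<sigma>0 where \<sigma>0: "\<sigma>0 \<in> facets K"
    using face_in_facet[OF sc] sc by (metis simplicial_complex_def all_not_in_conv)
  obtain vs0 where vs0: "distinct vs0" "set vs0 = \<sigma>0"
    using finite_distinct_list simplicial_complex_finite_face[OF sc] facet_sub(1)[OF \<sigma>0] by metis
  obtain a0 a1 a2 a3 a4 where vs0_eq: "vs0 = [a0, a1, a2, a3, a4]"
    using indep(2)[of vs0] vs0 \<sigma>0 by (metis length5E)
  \<comment> \<open>One facet supplies five independent colours, so the set of all colours
    spans.\<close>
  have "indep [u a0, u a1, u a2, u a3, u a4]"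
    using indep(1)[of vs0] vs0 \<sigma>0 by (simp add: vs0_eq)
  moreover have "{u a0, u a1, u a2, u a3, u a4} \<subseteq> u ` \<Union>K"
    using facet_sub(2)[OF \<sigma>0] vs0(2) by (auto simp: vs0_eq)
  moreover have "card (u ` \<Union>K) \<le> 10"
    using card_image_le[of "\<Union>K" u] sc card by (simp add: simplicial_complex_def)
  ultimately obtain bs where bs: "length bs = 5" "indep bs" "\<And>w. w \<in> set forbidden_codes \<Longrightarrow> comb bs w \<notin> u ` \<Union>K"
    using bit5.exists_basis_avoiding_forbidden_codes[OF card_UNIV_bit5] by metis
  have "\<exists>k. length k = 5 \<and> comb bs k = x" for x
  proof -
    have "x \<in> comb bs ` codes 5"
      using bit5.bij_betw_comb[OF bs(2)] card_UNIV_bit5 bs(1) by (simp add: bij_betw_def)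
    then show ?thesis by (auto simp: codes_def)
  qed
  then obtain code where code: "\<And>x. length (code x) = 5" "\<And>x. comb bs (code x) = x"
    by metis
  define \<kappa> where "\<kappa> v = code (u v)" for v
  have \<kappa>: "length (\<kappa> v) = 5" "comb bs (\<kappa> v) = u v" for v by (simp_all add: \<kappa>_def code)
  \<comment> \<open>A zero colour would lie in the span of the other four colours of a facet through
    \<open>v\<close>.\<close>
  have nz: "True \<in> set (\<kappa> v)" if v: "v \<in> \<Union>K" for v
  proof (rule ccontr)
    assume "True \<notin> set (\<kappa> v)"
    then have "\<kappa> v = replicate 5 False" using \<kappa>(1)[of v] by (intro replicate_eqI) auto
    then have "u v = 0" using \<kappa>(2)[of v] by (metis comb_replicate_False)
    obtain \<rho> where "\<rho> \<in> K" "v \<in> \<rho>" using v by blast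
    then obtain \<sigma> where \<sigma>: "\<sigma> \<in> facets K" "v \<in> \<sigma>" using face_in_facet[OF sc] by blast
    obtain vs where vs: "distinct vs" "set vs = \<sigma> - {v}"
      using finite_distinct_list[of "\<sigma> - {v}"] simplicial_complex_finite_face[OF sc facet_sub(1)[OF \<sigma>(1)]] by auto
    then have "indep (map u (v # vs))" using \<sigma> by (intro indep(1)) (auto simp: insert_absorb)
    then have "u v \<notin> comb (map u vs) ` codes (length vs)" by (simp add: bit5.indep_Cons)
    moreover have "comb (map u vs) (replicate (length vs) False) = 0" by simp
    then have "0 \<in> comb (map u vs) ` codes (length vs)"
      by (intro image_eqI[of _ _ "replicate (length vs) False"]) (simp_all add: codes_def)
    ultimately show False using \<open>u v = 0\<close> by simp
  qed
  have in_allowed: "\<kappa> v \<in> set allowed_codes" if "v \<in> \<Union>K" for v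
    using bs(3)[of "\<kappa> v"] nz[OF that] \<kappa> that by (auto simp: set_allowed_codes)
  have main: "distinct (map \<kappa> vs)"
    "\<bar>det (mat_of_cols 5 (map (\<lambda>v. vec_of_code (\<kappa> v) :: int vec) vs))\<bar> = 1"
    if vs: "distinct vs" "set vs \<in> facets K" for vs
  proof -
    note ind = indep[OF vs]
    let ?zs = "map \<kappa> vs"
    have comb: "comb (map u vs) ks = comb bs (comb_codes 5 ?zs ks)" for ks
    proof -
      have "map u vs = map (comb bs) ?zs" by (simp add: \<kappa>)
      moreover have "\<forall>p\<in>set ?zs. length p = length bs" using \<kappa>(1) bs(1) by simp
      ultimately show ?thesis using bit5.comb_map_comb[of ?zs bs ks] bs(1) by metis
    qed
    have "inj_on c (set vs)" "\<forall>v\<in>set vs. c v \<in> carrier_vec 5"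
      using c facet_sub[OF vs(2)] by (auto simp: mod2_toric_coloring_def)
    moreover have "u v = u w" if "\<kappa> v = \<kappa> w" for v w using \<kappa>(2) that by metis
    ultimately show dist: "distinct ?zs"
      using vs(1) bit5_of_vec_inject unfolding distinct_map inj_on_def u_def by metis
    let ?D = "mat 5 5 (\<lambda>(r, j). of_bool (?zs ! r ! j)) :: int mat"
    \<comment> \<open>Oddness comes from independence on the facet, \<open>good_det\<close> from the
      evaluated list; together they leave only 1 and -1.\<close>
    have "odd (det ?D)"
    proof (rule odd_det_of_codes)
      fix ks assume ks: "length ks = 5" "comb_codes 5 ?zs ks = replicate 5 False"
      then have "comb (map u vs) ks = 0" by (simp only: comb comb_replicate_False)
      then show "True \<notin> set ks" using ind ks(1) by (simp add: indep_def)
    qed (simp_all add: ind \<kappa>)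
    moreover have "good_det (det ?D)"
    proof (rule good_det_of_unimodular_list[OF unimodular_allowed_codes distinct_allowed_codes _ dist])
      show "\<forall>z\<in>set allowed_codes. length z = 5" by (simp add: set_allowed_codes)
      show "set ?zs \<subseteq> set allowed_codes" using in_allowed facet_sub(2)[OF vs(2)] by (simp only: set_map) blast
    qed (simp add: ind)
    ultimately have "\<bar>det ?D\<bar> = 1" by (auto simp: good_det_def split: if_splits)
    moreover have "mat_of_cols 5 (map (\<lambda>v. vec_of_code (\<kappa> v) :: int vec) vs) = transpose_mat ?D"
      by (intro eq_matI) (auto simp: ind mat_of_cols_def vec_of_code_def)
    ultimately show "\<bar>det (mat_of_cols 5 (map (\<lambda>v. vec_of_code (\<kappa> v) :: int vec) vs))\<bar> = 1"
      by (simp add: det_transpose[of _ 5])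
  qed
  show ?thesis
    using nz \<kappa>(1) main by (intro exI[of _ \<kappa>] conjI ballI allI impI) simp_all
qed

theorem mainTheorem2:
  fixes K :: "nat set set"
  assumes "pl_sphere K"
    and "seed K"
    and "complex_dim K = 4"
    and "card (\<Union>K) = 10"
    and "mod2_toric_colorable K"
  shows "toric_colorable K \<and>
    (\<exists>c :: nat \<Rightarrow> int vec.
       (\<forall>v\<in>\<Union>K. c v \<in> carrier_vec 5 \<and> (\<forall>i<5. c v $ i \<in> {0, 1}) \<and> c v \<noteq> 0\<^sub>v 5) \<and>
       (\<forall>\<sigma>\<in>facets K. \<forall>vs. distinct vs \<and> set vs = \<sigma> \<longrightarrow>
          \<bar>det (mat_of_cols 5 (map c vs))\<bar> = 1))"
proof -
  have sc: "simplicial_complex K" using assms(1) by (simp add: pl_sphere_def)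
  have pure: "card \<sigma> = 5" if "\<sigma> \<in> facets K" for \<sigma>
    using pl_sphere_pure[OF assms(1) _ that, of 4] assms(3) by simp
  obtain c where "mod2_toric_coloring 5 K c"
    using assms(3,5) by (auto simp: mod2_toric_colorable_def)
  then obtain \<kappa> where \<kappa>: "\<And>v. v \<in> \<Union>K \<Longrightarrow> length (\<kappa> v) = 5 \<and> True \<in> set (\<kappa> v)"
    and det: "\<And>vs. distinct vs \<Longrightarrow> set vs \<in> facets K \<Longrightarrow> distinct (map \<kappa> vs) \<and>
       \<bar>det (mat_of_cols 5 (map (\<lambda>v. vec_of_code (\<kappa> v) :: int vec) vs))\<bar> = 1"
    using exists_zero_one_coloring[OF sc pure] assms(4) by (metis order_refl)
  define d :: "nat \<Rightarrow> int vec" where "d v = vec_of_code (\<kappa> v)" for v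
  have d_inj: "inj_on d \<sigma>" and d_basis: "integral_basis 5 (d ` \<sigma>)" if \<sigma>: "\<sigma> \<in> facets K" for \<sigma>
  proof -
    have "\<sigma> \<in> K" using \<sigma> by (simp add: facets_def)
    then obtain vs where vs: "distinct vs" "set vs = \<sigma>"
      using finite_distinct_list simplicial_complex_finite_face[OF sc] by metis
    then have "inj_on \<kappa> \<sigma>" using det[of vs] \<sigma> by (simp add: distinct_map)
    moreover have "length (\<kappa> v) = 5" if "v \<in> \<sigma>" for v using \<kappa> \<open>\<sigma> \<in> K\<close> that by blast
    ultimately show "inj_on d \<sigma>"
      unfolding inj_on_def d_def using vec_of_code_inject by metis
    have "length vs = 5" using pure[OF \<sigma>] distinct_card[OF vs(1)] vs(2) by simp
    then have "integral_basis 5 (set (map d vs))"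
      using det[of vs] vs \<sigma> by (intro integral_basis_of_unimodular) (auto simp: d_def[abs_def])
    then show "integral_basis 5 (d ` \<sigma>)" using vs(2) by simp
  qed
  have "toric_coloring 5 K d"
    unfolding toric_coloring_def
  proof (intro conjI ballI)
    fix \<sigma> assume "\<sigma> \<in> K"
    \<comment> \<open>The colours of a facet containing the face serve as the required extension to
      a basis.\<close>
    then obtain \<tau> where \<tau>: "\<tau> \<in> facets K" "\<sigma> \<subseteq> \<tau>" using face_in_facet[OF sc] by blast
    then show "inj_on d \<sigma>" using d_inj inj_on_subset by blast
    show "\<exists>B. d ` \<sigma> \<subseteq> B \<and> integral_basis 5 B" using d_basis \<tau> by blast
  qed (simp add: d_def)
  then have "toric_colorable K"
    using assms(3) by (auto simp: toric_colorable_def)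
  moreover have "d v \<in> carrier_vec 5 \<and> (\<forall>i<5. d v $ i \<in> {0, 1}) \<and> d v \<noteq> 0\<^sub>v 5" if v: "v \<in> \<Union>K" for v
  proof -
    obtain i where i: "i < 5" "\<kappa> v ! i" using \<kappa>[OF v] by (metis in_set_conv_nth)
    then have "d v $ i = 1" by (simp add: d_def vec_of_code_def)
    then have "d v \<noteq> 0\<^sub>v 5" using i(1) by auto
    then show ?thesis by (auto simp: d_def vec_of_code_def)
  qed
  moreover have "\<forall>\<sigma>\<in>facets K. \<forall>vs. distinct vs \<and> set vs = \<sigma> \<longrightarrow> \<bar>det (mat_of_cols 5 (map d vs))\<bar> = 1"
    using det by (auto simp: d_def[abs_def])
  ultimately show ?thesis by blast
qed

end
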